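(* Let $q$ be an odd prime. Then $$ \mathfrak{G}_q - \mathfrak{G}_q^+ = \sum_{\chi\ \mathrm{odd}} \frac{L'}{L}(1,\chi) = \frac{q-1}{2}\bigl(\gamma+\log(2\pi)\bigr) + \sum_{\chi\ \mathrm{odd}} \frac{1}{B_{1,\overline{\chi}}}\sum_{a=1}^{q-1}\overline{\chi}(a)\log\Bigl(\Gamma\bigl(\tfrac{a}{q}\bigr)\Bigr), $$ where the sums over $\chi$ run over the odd Dirichlet characters modulo $q$.
   Context: Here $\gamma$ is the Euler-Mascheroni constant, $\Gamma$ is Euler's Gamma function, $\chi_0$ is the trivial (principal) Dirichlet character modulo $q$, and $L(s,\chi)$ is the Dirichlet $L$-function of $\chi$. A Dirichlet character $\chi$ is even if $\chi(-1)=1$ and odd if $\chi(-1)=-1$. The Euler-Kronecker constant $\mathfrak{G}_q$ of the prime cyclotomic field $\mathbb{Q}(\zeta_q)$ ($\zeta_q$ a primitive $q$-th root of unity) and the Euler-Kronecker constant $\mathfrak{G}_q^+$ of its maximal real subfield $\mathbb{Q}(\zeta_q+\zeta_q^{-1})$ are given by $$ \mathfrak{G}_q := \gamma + \sum_{\chi\neq\chi_0} \frac{L'}{L}(1,\chi), \qquad \mathfrak{G}_q^+ := \gamma + \sum_{\substack{\chi\neq\chi_0\\ \chi\ \mathrm{even}}} \frac{L'}{L}(1,\chi), $$ the sums being over the non-trivial (respectively non-trivial even) Dirichlet characters modulo $q$ (an empty sum is $0$). For an odd Dirichlet character $\chi$ modulo $q$, the first $\chi$-Bernoulli number is $$ B_{1,\chi}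 := \frac{1}{q}\sum_{a=1}^{q-1} a\,\chi(a), $$ which is non-zero because $\chi$ is odd. *)

theory Defs
  imports "HOL-Complex_Analysis.Complex_Analysis" "HOL-Number_Theory.Number_Theory"
begin

section \<open>Dirichlet characters\<close>

text \<open>
  Characters are functions on the integers, extended by zero to the residues that are not
  coprime to the modulus. The value at \<open>1\<close> is \<open>1\<close> by multiplicativity, being non-zero.
\<close>

definition dirichlet_character :: "nat \<Rightarrow> (int \<Rightarrow> complex) \<Rightarrow> bool" where
  "dirichlet_character q chi \<longleftrightarrow>
     (\<forall>m n. chi (m * n) = chi m * chi n) \<and>
     (\<forall>n. chi (n + int q) = chi n) \<and>
     (\<forall>n. chi n \<noteq> 0 \<longleftrightarrow> coprime n (int q))"

definition principal_character :: "nat \<Rightarrow> int \<Rightarrow> complex" where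
  "principal_character q n = (if coprime n (int q) then 1 else 0)"

definition nontrivial_characters :: "nat \<Rightarrow> (int \<Rightarrow> complex) set" where
  "nontrivial_characters q = {chi. dirichlet_character q chi \<and> chi \<noteq> principal_character q}"

definition even_nontrivial_characters :: "nat \<Rightarrow> (int \<Rightarrow> complex) set" where
  "even_nontrivial_characters q = {chi \<in> nontrivial_characters q. chi (-1) = 1}"

definition odd_characters :: "nat \<Rightarrow> (int \<Rightarrow> complex) set" where
  "odd_characters q = {chi. dirichlet_character q chi \<and> chi (-1) = -1}"

definition conj_character :: "(int \<Rightarrow> complex) \<Rightarrow> int \<Rightarrow> complex" where
  "conj_character chi n = cnj (chi n)"


section \<open>L-functions, Bernoulli numbers and Euler-Kronecker constants\<close>

text \<open>
  The Dirichlet series, summed in its natural order. For a non-principal character it converges,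
  and is holomorphic, on the whole half-plane \<open>Re s > 0\<close> (see the lemmas
  \<open>dirichlet_L_sums\<close> and \<open>dirichlet_L_holomorphic\<close> below), so there it agrees with the
  analytic continuation of the series from \<open>Re s > 1\<close>. Outside of this half-plane, and
  for a principal character outside of \<open>Re s > 1\<close>, the value is meaningless.
\<close>

definition dirichlet_L :: "(int \<Rightarrow> complex) \<Rightarrow> complex \<Rightarrow> complex" where
  "dirichlet_L chi s = (\<Sum>n. chi (int (Suc n)) / of_nat (Suc n) powr s)"

definition L_logderiv_at_1 :: "(int \<Rightarrow> complex) \<Rightarrow> complex" where
  "L_logderiv_at_1 chi = deriv (dirichlet_L chi) 1 / dirichlet_L chi 1"

definition bernoulli1 :: "nat \<Rightarrow> (int \<Rightarrow> complex) \<Rightarrow> complex" where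
  "bernoulli1 q chi = 1 / of_nat q * (\<Sum>a = 1..q-1. of_nat a * chi (int a))"

definition euler_kronecker :: "nat \<Rightarrow> complex" where
  "euler_kronecker q = euler_mascheroni + (\<Sum>chi\<in>nontrivial_characters q. L_logderiv_at_1 chi)"

definition euler_kronecker_plus :: "nat \<Rightarrow> complex" where
  "euler_kronecker_plus q =
     euler_mascheroni + (\<Sum>chi\<in>even_nontrivial_characters q. L_logderiv_at_1 chi)"


section \<open>Well-definedness\<close>

lemma dirichlet_character_mult: "dirichlet_character q chi \<Longrightarrow> chi (m * n) = chi m * chi n"
  by (auto simp: dirichlet_character_def)

lemma dirichlet_character_nz: "dirichlet_character q chi \<Longrightarrow> chi n \<noteq> 0 \<longleftrightarrow> coprime n (int q)"
  by (auto simp: dirichlet_character_def)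

lemma dirichlet_character_periodic: "dirichlet_character q chi \<Longrightarrow> chi (n + int q) = chi n"
  by (auto simp: dirichlet_character_def)

lemma dirichlet_character_1:
  assumes "dirichlet_character q chi"
  shows "chi 1 = 1"
  using dirichlet_character_mult[OF assms, of 1 1] dirichlet_character_nz[OF assms, of 1] by auto

lemma dirichlet_character_mod:
  assumes "dirichlet_character q chi"
  shows "chi (n mod int q) = chi n"
proof -
  have 1: "chi (m + int k * int q) = chi m" for m k
  proof (induction k)
    case (Suc k)
    have "m + int (Suc k) * int q = (m + int k * int q) + int q" by (simp add: algebra_simps)
    with Suc show ?case by (simp only: dirichlet_character_periodic[OF assms])
  qed auto
  have 2: "chi (m + k * int q) = chi m" for m k
  proof (cases "k \<ge> 0")
    case True
    then show ?thesis using 1[of m "nat k"] by simp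
  next
    case False
    then show ?thesis using 1[of "m + k * int q" "nat (-k)"] by simp
  qed
  from 2[of "n mod int q" "n div int q"] show ?thesis by simp
qed

lemma principal_character_is_character: "dirichlet_character q (principal_character q)"
proof -
  have "coprime (n + int q) (int q) \<longleftrightarrow> coprime n (int q)" for n
    unfolding coprime_iff_gcd_eq_1 by (simp only: gcd_add1)
  thus ?thesis by (simp add: dirichlet_character_def principal_character_def)
qed

lemma dirichlet_character_power:
  assumes "dirichlet_character q chi"
  shows "chi (n ^ k) = chi n ^ k"
  by (induction k) (simp_all add: dirichlet_character_1[OF assms] dirichlet_character_mult[OF assms])

lemma dirichlet_character_root_of_unity:
  assumes "dirichlet_character q chi" "coprime n (int q)" "q > 0"
  shows "chi n ^ totient q = 1"
proof -
  define m where "m = nat (n mod int q)"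
  have m: "int m = n mod int q" using assms(3) by (simp add: m_def)
  have "coprime (int m) (int q)" using assms(2,3) by (simp add: m)
  hence "coprime m q" by simp
  hence "[m ^ totient q = 1] (mod q)" by (rule euler_theorem)
  hence "int (m ^ totient q) mod int q = 1 mod int q"
    by (metis cong_def of_nat_1 zmod_int)
  hence "chi (int (m ^ totient q)) = chi 1"
    using dirichlet_character_mod[OF assms(1)] by metis
  thus ?thesis
    by (simp add: dirichlet_character_power[OF assms(1)] m dirichlet_character_mod[OF assms(1)]
        dirichlet_character_1[OF assms(1)])
qed

lemma dirichlet_character_norm_le_1:
  assumes "dirichlet_character q chi" "q > 0"
  shows "norm (chi n) \<le> 1"
proof (cases "coprime n (int q)")
  case True
  have "norm (chi n) ^ totient q = 1 ^ totient q"
    using dirichlet_character_root_of_unity[OF assms(1) True assms(2)]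
    by (metis norm_one norm_power power_one)
  moreover have "totient q > 0" using assms(2) by simp
  ultimately have "norm (chi n) = 1"
    by (metis norm_ge_zero power_eq_imp_eq_base zero_le_one)
  thus ?thesis by simp
next
  case False
  thus ?thesis using dirichlet_character_nz[OF assms(1), of n] by auto
qed

lemma finite_dirichlet_characters:
  assumes "q > 0"
  shows "finite {chi. dirichlet_character q chi}"
proof -
  define R where "R = insert 0 {z :: complex. z ^ totient q = 1}"
  have fin: "finite R"
  proof -
    have "totient q > 0" using assms by simp
    hence "totient q \<ge> 1" by linarith
    thus ?thesis unfolding R_def using finite_roots_unity by blast
  qed
  define F where "F = (\<lambda>chi :: int \<Rightarrow> complex. restrict chi {0..<int q})"
  have "finite (PiE {0..<int q} (\<lambda>_. R))" using fin by (intro finite_PiE) auto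
  moreover have "F ` {chi. dirichlet_character q chi} \<subseteq> PiE {0..<int q} (\<lambda>_. R)"
  proof -
    have "chi n \<in> R" if "dirichlet_character q chi" for chi n
      using dirichlet_character_root_of_unity[OF that _ assms, of n] dirichlet_character_nz[OF that, of n]
      unfolding R_def by blast
    thus ?thesis unfolding F_def by auto
  qed
  ultimately have "finite (F ` {chi. dirichlet_character q chi})" by (rule finite_subset[rotated])
  moreover have "inj_on F {chi. dirichlet_character q chi}"
  proof (rule inj_onI, clarsimp)
    fix chi \<psi> assume *: "dirichlet_character q chi" "dirichlet_character q \<psi>" "F chi = F \<psi>"
    show "chi = \<psi>"
    proof
      fix n
      have "n mod int q \<in> {0..<int q}" using assms by simp
      hence "chi (n mod int q) = \<psi> (n mod int q)"
        using fun_cong[OF *(3), of "n mod int q"] by (simp add: F_def)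
      thus "chi n = \<psi> n"
        using dirichlet_character_mod *(1,2) by metis
    qed
  qed
  ultimately show ?thesis by (rule finite_imageD)
qed

lemma sum_nontrivial_character:
  assumes "chi \<in> nontrivial_characters q" "q > 0"
  shows "(\<Sum>n<q. chi (int n)) = 0"
proof -
  have ch: "dirichlet_character q chi" and "chi \<noteq> principal_character q"
    using assms by (auto simp: nontrivial_characters_def)
  then obtain a where a: "coprime a (int q)" "chi a \<noteq> 1"
    using dirichlet_character_nz[OF ch] by (fastforce simp: principal_character_def)
  define S where "S = (\<Sum>n\<in>{0..<int q}. chi n)"
  have inj: "inj_on (\<lambda>n. (a * n) mod int q) {0..<int q}"
  proof (rule inj_onI)
    fix x y assume xy: "x \<in> {0..<int q}" "y \<in> {0..<int q}" "a * x mod int q = a * y mod int q"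
    hence "[a * x = a * y] (mod int q)" by (simp add: cong_def)
    hence "[x = y] (mod int q)" using a(1) by (simp add: cong_mult_lcancel)
    thus "x = y" using xy(1,2) by (simp add: cong_def)
  qed
  have img: "(\<lambda>n. (a * n) mod int q) ` {0..<int q} = {0..<int q}"
    by (rule endo_inj_surj) (use inj assms(2) in auto)
  have "chi a * S = (\<Sum>n\<in>{0..<int q}. chi ((a * n) mod int q))"
    by (simp add: S_def sum_distrib_left dirichlet_character_mod[OF ch] dirichlet_character_mult[OF ch])
  also have "\<dots> = (\<Sum>n\<in>(\<lambda>n. (a * n) mod int q) ` {0..<int q}. chi n)"
    using inj by (simp add: sum.reindex)
  also have "\<dots> = S" by (simp add: img S_def)
  finally have "(chi a - 1) * S = 0" by (simp add: algebra_simps)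
  hence "S = 0" using a(2) by simp
  moreover have "S = (\<Sum>n<q. chi (int n))"
    unfolding S_def by (rule sum.reindex_bij_witness[of _ int nat]) auto
  ultimately show ?thesis by simp
qed

lemma nontrivial_character_partial_sums_bounded:
  assumes "chi \<in> nontrivial_characters q" "q > 0"
  shows "norm (\<Sum>k<n. chi (int (Suc k))) \<le> real q"
proof -
  have ch: "dirichlet_character q chi" using assms by (auto simp: nontrivial_characters_def)
  define A where "A = (\<lambda>n. \<Sum>k<n. chi (int (Suc k)))"
  have "(\<Sum>k<Suc q. chi (int k)) = chi 0 + A q"
    unfolding A_def by (subst sum.lessThan_Suc_shift) simp
  moreover have "chi (int q) = chi 0" using dirichlet_character_periodic[OF ch, of 0] by simp
  ultimately have Aq: "A q = 0" using sum_nontrivial_character[OF assms] by simp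
  have per: "A (n + q) = A n" for n
  proof (induction n)
    case 0
    then show ?case using Aq by (simp add: A_def)
  next
    case (Suc n)
    have "int (Suc (n + q)) = int (Suc n) + int q" by simp
    with Suc show ?case
      unfolding A_def by (simp only: add_Suc sum.lessThan_Suc dirichlet_character_periodic[OF ch])
  qed
  have "norm (A n) \<le> real q"
  proof (induction n rule: less_induct)
    case (less n)
    show ?case
    proof (cases "n < q")
      case True
      have "norm (A n) \<le> (\<Sum>k<n. 1)"
        unfolding A_def by (rule sum_norm_le) (rule dirichlet_character_norm_le_1[OF ch assms(2)])
      with True show ?thesis by simp
    next
      case False
      with less[of "n - q"] per[of "n - q"] assms(2) show ?thesis by simp
    qed
  qed
  thus ?thesis by (simp add: A_def)
qed

lemma powr_diff_bound:
  fixes s :: complex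
  assumes "Re s > 0"
  shows "norm (of_nat (Suc n) powr (-s) - of_nat (Suc (Suc n)) powr (-s))
           \<le> norm s * real (Suc n) powr (- Re s - 1)"
proof -
  define S where "S = closed_segment (of_nat (Suc n)) (of_nat (Suc (Suc n)) :: complex)"
  have S: "\<exists>x. z = of_real x \<and> x \<ge> real (Suc n)" if "z \<in> S" for z
  proof -
    have "z \<in> of_real ` closed_segment (real (Suc n)) (real (Suc (Suc n)))"
      using that unfolding S_def by (metis closed_segment_of_real of_real_of_nat_eq)
    thus ?thesis by (auto simp: closed_segment_eq_real_ivl)
  qed
  have "norm ((\<lambda>z. z powr (-s)) (of_nat (Suc n)) - (\<lambda>z. z powr (-s)) (of_nat (Suc (Suc n))))
      \<le> (norm s * real (Suc n) powr (- Re s - 1))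
          * norm (of_nat (Suc n) - of_nat (Suc (Suc n)) :: complex)"
  proof (rule field_differentiable_bound[where S = S])
    show "convex S" by (simp add: S_def)
    fix z assume "z \<in> S"
    from S[OF this] obtain x where x: "z = of_real x" "x \<ge> real (Suc n)" by blast
    hence x0: "x > 0" by simp
    show "((\<lambda>z. z powr (-s)) has_field_derivative (-s) * z powr (-s - 1)) (at z within S)"
      using x0 x(1) by (intro has_field_derivative_at_within[OF has_field_derivative_powr]) auto
    have "norm ((-s) * z powr (-s - 1)) = norm s * x powr (- Re s - 1)"
      using x0 by (simp add: x(1) norm_mult norm_powr_real_powr)
    also have "\<dots> \<le> norm s * real (Suc n) powr (- Re s - 1)"
      using x(2) assms by (intro mult_left_mono powr_mono2') auto
    finally show "norm ((-s) * z powr (-s - 1)) \<le> norm s * real (Suc n) powr (- Re s - 1)" .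
  qed (auto simp: S_def)
  thus ?thesis by simp
qed

lemma dirichlet_L_sums_holomorphic:
  assumes "chi \<in> nontrivial_characters q" "q > 0"
  shows "Re s > 0 \<Longrightarrow> (\<lambda>n. chi (int (Suc n)) / of_nat (Suc n) powr s) sums dirichlet_L chi s"
    and "dirichlet_L chi holomorphic_on {s. Re s > 0}"
proof -
  define A where "A = (\<lambda>n. \<Sum>k<n. chi (int (Suc k)))"
  define u where "u = (\<lambda>n s :: complex. of_nat (Suc n) powr (-s) :: complex)"
  define u' where "u' = (\<lambda>n s :: complex. - ln (of_nat (Suc n)) * of_nat (Suc n) powr (-s) :: complex)"
  define f where "f = (\<lambda>n s. A (Suc n) * (u n s - u (Suc n) s))"
  define f' where "f' = (\<lambda>n s. A (Suc n) * (u' n s - u' (Suc n) s))"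
  have A: "norm (A n) \<le> real q" for n
    unfolding A_def by (rule nontrivial_character_partial_sums_bounded[OF assms])
  have deriv_u: "(u n has_field_derivative u' n s) (at s)" for n s
  proof -
    have "((\<lambda>s. of_nat (Suc n) powr s :: complex) has_field_derivative
            ln (of_nat (Suc n)) * of_nat (Suc n) powr (-s)) (at (-s))"
      by (rule has_field_derivative_powr_right) (simp del: of_nat_Suc)
    from DERIV_chain2[OF this DERIV_minus[OF DERIV_ident]] show ?thesis
      unfolding u_def u'_def by simp
  qed
  have parts: "(\<Sum>k<N. chi (int (Suc k)) / of_nat (Suc k) powr s) = A N * u N s + (\<Sum>k<N. f k s)"
    for N s
  proof (induction N)
    case (Suc N)
    have "A (Suc N) = A N + chi (int (Suc N))" by (simp add: A_def)
    with Suc show ?case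
      by (simp add: f_def algebra_simps u_def powr_minus divide_inverse del: of_nat_Suc)
  qed (simp add: A_def)
  have "\<exists>g g'. \<forall>s\<in>{s. Re s > 0}. (\<lambda>n. f n s) sums g s \<and> (\<lambda>n. f' n s) sums g' s \<and>
          (g has_field_derivative g' s) (at s)"
  proof (rule series_and_derivative_comparison_local)
    show "open {s. Re s > 0}" by (rule open_halfspace_Re_gt)
    show "(f n has_field_derivative f' n s) (at s)" if "s \<in> {s. Re s > 0}" for n s
      unfolding f_def f'_def by (intro DERIV_cmult DERIV_diff deriv_u)
    fix s :: complex assume "s \<in> {s. Re s > 0}"
    hence s: "Re s > 0" by simp
    define d where "d = Re s / 2"
    define h where "h = (\<lambda>n. real q * ((norm s + d) * real (Suc n) powr (- d - 1)))"
    have d: "d > 0" using s by (simp add: d_def)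
    have "summable (\<lambda>n. real n powr (- d - 1))"
      using d by (subst summable_real_powr_iff) auto
    hence "summable (\<lambda>n. real (Suc n) powr (- d - 1))"
      by (subst summable_Suc_iff)
    hence "summable h" unfolding h_def by (intro summable_mult)
    moreover have "norm (f n t) \<le> h n" if "t \<in> ball s d" for n t
    proof -
      have t: "norm (t - s) < d" using that by (simp add: dist_norm norm_minus_commute)
      have "Re s - Re t \<le> norm (t - s)"
        using abs_Re_le_cmod[of "t - s"] by simp
      hence Ret: "Re t \<ge> d" using t by (simp add: d_def)
      have nt: "norm t \<le> norm s + d" using t norm_triangle_sub[of t s] by simp
      have "norm (u n t - u (Suc n) t) \<le> norm t * real (Suc n) powr (- Re t - 1)"
        unfolding u_def using Ret d by (intro powr_diff_bound) auto
      also have "\<dots> \<le> (norm s + d) * real (Suc n) powr (- d - 1)"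
        using nt Ret d by (intro mult_mono powr_mono) auto
      finally show ?thesis
        unfolding f_def h_def norm_mult using A by (intro mult_mono) auto
    qed
    ultimately show "\<exists>d h. 0 < d \<and> summable h \<and>
        (\<forall>\<^sub>F n in sequentially. \<forall>t\<in>ball s d \<inter> {s. Re s > 0}. norm (f n t) \<le> h n)"
      using d by (intro exI[of _ d] exI[of _ h]) auto
  qed
  then obtain g g' where g: "\<And>s. Re s > 0 \<Longrightarrow> (\<lambda>n. f n s) sums g s"
      "\<And>s. Re s > 0 \<Longrightarrow> (g has_field_derivative g' s) (at s)" by blast
  have sums: "(\<lambda>n. chi (int (Suc n)) / of_nat (Suc n) powr s) sums g s" if s: "Re s > 0" for s
  proof -
    have "(\<lambda>N. A N * u N s) \<longlonglongrightarrow> 0"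
    proof (rule Lim_null_comparison)
      show "\<forall>\<^sub>F N in sequentially. norm (A N * u N s) \<le> real q * real (Suc N) powr (- Re s)"
        using A by (auto simp: norm_mult u_def norm_powr_real_powr simp del: of_nat_Suc
            intro!: mult_mono always_eventually)
      have "(\<lambda>N. real (Suc N) powr (- Re s)) \<longlonglongrightarrow> 0"
        using s by (intro tendsto_neg_powr filterlim_compose[OF filterlim_real_sequentially]
            filterlim_Suc) auto
      from tendsto_mult_left[OF this, of "real q"]
      show "(\<lambda>N. real q * real (Suc N) powr (- Re s)) \<longlonglongrightarrow> 0" by simp
    qed
    from tendsto_add[OF this g(1)[OF s, unfolded sums_def]] show ?thesis
      by (simp only: sums_def parts add_0_left)
  qed
  hence L: "dirichlet_L chi s = g s" if "Re s > 0" for s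
    using that unfolding dirichlet_L_def by (simp add: sums_iff)
  show "(\<lambda>n. chi (int (Suc n)) / of_nat (Suc n) powr s) sums dirichlet_L chi s" if "Re s > 0"
    using sums[OF that] L[OF that] by simp
  have "g holomorphic_on {s. Re s > 0}"
    using g(2) by (auto simp: holomorphic_on_open open_halfspace_Re_gt)
  thus "dirichlet_L chi holomorphic_on {s. Re s > 0}"
    by (rule holomorphic_transform) (simp add: L)
qed

lemmas dirichlet_L_sums = dirichlet_L_sums_holomorphic(1)
lemmas dirichlet_L_holomorphic = dirichlet_L_sums_holomorphic(2)

end

theory Submission
  imports Defs "HOL-Number_Theory.Prime_Powers" "HOL-Real_Asymp.Real_Asymp"
begin

text \<open>
  Since \<open>chi (-1)\<close> is \<open>1\<close> or \<open>-1\<close>, the non-trivial characters split into the even non-trivial ones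
  and the odd ones, which is the first equality (\<open>euler_kronecker_diff\<close>). There are \<open>(q - 1) / 2\<close> odd
  characters (\<open>card_odd_characters\<close>), so the second equality is the sum over the odd characters of
  the individual identity \<open>L_logderiv_at_1_eq\<close>, which says that \<open>L'/L(1, chi)\<close> equals
  \<open>\<gamma> + log (2 \<pi>)\<close> plus \<open>1 / B\<close> times the sum of \<open>cnj (chi a) log \<Gamma>(a/q)\<close> over \<open>0 < a < q\<close>.
  Here \<open>B\<close> is the first Bernoulli number of the conjugate character.

  The individual identity comes from one contour integral. Write \<open>e(z) = exp (2 \<pi> i z)\<close>, let \<open>\<tau>\<close> be
  the Gauss sum of \<open>chi\<close>, and let \<open>h(z)\<close> be the sum of \<open>chi a * e(a z)\<close> over \<open>0 < a < q\<close>, divided by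
  \<open>1 - e(q z)\<close>. This function has period 1, decays exponentially away from the real axis, and its
  only poles in a period are at \<open>k/q\<close> for \<open>0 < k < q\<close>, with residues proportional to \<open>cnj (chi k) * \<tau>\<close>. It is
  even because \<open>chi\<close> is odd, and for \<open>y > 0\<close> the value \<open>h(i y)\<close> is the sum of the series
  \<open>chi n * exp (- 2 \<pi> n y)\<close>. Let \<open>H\<close> be holomorphic on the right half-plane, of polynomial growth for
  \<open>\<bar>Im z\<bar> \<ge> 1\<close>, and put \<open>D(z) = H(z + 1) - H(z)\<close>. Integrate \<open>h H\<close> around a tall rectangle
  over \<open>\<epsilon> \<le> Re z \<le> 1 + \<epsilon>\<close>: by periodicity the vertical sides together give the integral of \<open>h D\<close> over
  the line \<open>Re z = \<epsilon>\<close>. As \<open>\<epsilon>\<close> tends to \<open>0\<close> this becomes \<open>chi_kernel_contour_formula\<close>, which expresses the integral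
  of \<open>h(i y) (D(i y) + D(-i y))\<close> over \<open>y > 0\<close> by the sum of \<open>cnj (chi k) * H(k/q)\<close>.

  It is applied to \<open>H(z) = z\<close> with \<open>D = 1\<close>, and to \<open>H = log \<Gamma>\<close> with \<open>D = log\<close>. The integrals that arise,
  of \<open>h(i y)\<close> and of \<open>h(i y) log y\<close>, are the value and the derivative at \<open>s = 1\<close> of the Mellin
  transform of \<open>h(i y)\<close>, which is \<open>(2 \<pi>) powr - s * \<Gamma>(s) * L(s, chi)\<close> (\<open>chi_kernel_mellin\<close>). With
  \<open>\<Gamma>'(1) = - \<gamma>\<close> the results are formulas for \<open>L(1, chi)\<close> (\<open>dirichlet_L_1_eq\<close>) and \<open>L'(1, chi)\<close>
  (\<open>deriv_dirichlet_L_1_eq\<close>) with the common factor \<open>i \<pi> \<tau> / q\<close>, which cancels in the quotient.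

  The division requires \<open>L(1, chi) \<noteq> 0\<close> (\<open>dirichlet_L_1_nonzero\<close>). If the square of \<open>chi\<close> is
  non-trivial, this follows from the inequality \<open>3 + 4 cos t + cos (2 t) \<ge> 0\<close>, applied to the
  logarithmic derivatives of the L-functions of the powers of \<open>chi\<close> as \<open>s\<close> decreases to \<open>1\<close>
  (\<open>dirichlet_L_nonzero_complex\<close>). If the square is trivial, then \<open>q \<equiv> 3 (mod 4)\<close> and \<open>q B\<close> is an odd
  integer (\<open>bernoulli1_nonzero_quadratic\<close>), and the Gauss sum does not vanish either.
\<close>

section \<open>Dirichlet characters modulo an odd prime\<close>

lemma primitive_root_exists:
  assumes "prime q" "odd (q::nat)"
  obtains g where "coprime q g" "ord q g = q - 1"
    "\<And>n. coprime n (int q) \<Longrightarrow> \<exists>i. [int (g ^ i) = n] (mod int q)"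
proof -
  from residue_primroot_odd_prime_power_exists[OF assms] obtain g
    where g: "\<forall>k>0. residue_primroot (q ^ k) g" .
  from g[rule_format, of 1] have g: "residue_primroot q g" by simp
  have q: "q > 1" using assms prime_gt_1_nat by blast
  have "\<exists>i. [int (g ^ i) = n] (mod int q)" if n: "coprime n (int q)" for n
  proof -
    define k where "k = nat (n mod int q)"
    have k: "int k = n mod int q" using q by (simp add: k_def)
    have "coprime (int k) (int q)" using n q by (simp add: k)
    hence ck: "coprime k q" by simp
    have "k < q" using q by (simp add: k_def nat_less_iff)
    moreover have "k \<noteq> 0" using ck q by (cases k) auto
    ultimately have "k \<in> totatives q" using ck by (simp add: totatives_def)
    with residue_primroot_is_generator[OF q g] obtain i where "g ^ i mod q = k"
      unfolding bij_betw_def by (auto elim!: equalityE)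
    hence "int (g ^ i) mod int q = n mod int q" using k zmod_int[of "g ^ i" q] by simp
    thus ?thesis by (auto simp: cong_def)
  qed
  with g assms show ?thesis
    by (intro that[of g]) (auto simp: residue_primroot_def totient_prime)
qed

lemma primitive_root_half_power:
  assumes "prime q" "odd (q::nat)" "coprime q g" "ord q g = q - 1"
  shows "[int (g ^ ((q - 1) div 2)) = -1] (mod int q)"
proof -
  define m where "m = (q - 1) div 2"
  have m: "2 * m = q - 1" and m0: "0 < m" "m < q - 1" using assms(2) prime_gt_1_nat[OF assms(1)]
    by (auto simp: m_def elim!: oddE)
  have "[g ^ (q - 1) = 1] (mod q)" using assms(4) ord_divides[of g "q - 1" q] by simp
  hence "[int (g ^ (q - 1)) = 1] (mod int q)" using cong_int_iff[of "g ^ (q - 1)" 1 q] by simp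
  hence "int q dvd int g ^ (2 * m) - 1" using m by (simp add: cong_iff_dvd_diff)
  also have "int g ^ (2 * m) - 1 = (int g ^ m - 1) * (int g ^ m + 1)"
    by (simp add: algebra_simps power_mult power2_eq_square power_mult_distrib mult_2 power_add)
  finally have "int q dvd int g ^ m - 1 \<or> int q dvd int g ^ m + 1"
    using assms(1) by (simp add: prime_dvd_mult_iff)
  moreover have "\<not> int q dvd int g ^ m - 1"
  proof
    assume "int q dvd int g ^ m - 1"
    hence "[int (g ^ m) = int 1] (mod int q)" by (simp add: cong_iff_dvd_diff)
    hence "[g ^ m = 1] (mod q)" by (simp only: cong_int_iff)
    hence "(q - 1) dvd m" using assms(4) ord_divides[of g m q] by simp
    thus False using m0 nat_dvd_not_less by blast
  qed
  ultimately show ?thesis by (simp add: cong_iff_dvd_diff m_def)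
qed

lemma dirichlet_character_cong:
  assumes "dirichlet_character q chi" "[m = n] (mod int q)"
  shows "chi m = chi n"
  using dirichlet_character_mod[OF assms(1), of m] dirichlet_character_mod[OF assms(1), of n] assms(2)
  by (simp add: cong_def)

lemma dirichlet_character_determined_by_primitive_root:
  assumes "\<And>n. coprime n (int q) \<Longrightarrow> \<exists>i. [int (g ^ i) = n] (mod int q)"
    and "dirichlet_character q chi" "dirichlet_character q psi" "chi (int g) = psi (int g)"
  shows "chi = psi"
proof
  fix n
  show "chi n = psi n"
  proof (cases "coprime n (int q)")
    case True
    then obtain i where i: "[int (g ^ i) = n] (mod int q)" using assms(1) by blast
    hence "chi n = chi (int g) ^ i" "psi n = psi (int g) ^ i"
      using dirichlet_character_cong[OF assms(2) i] dirichlet_character_cong[OF assms(3) i]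
        dirichlet_character_power[OF assms(2), of "int g" i]
        dirichlet_character_power[OF assms(3), of "int g" i] by auto
    with assms(4) show ?thesis by simp
  next
    case False
    thus ?thesis using dirichlet_character_nz assms(2,3) by metis
  qed
qed

text \<open>
  A character is determined by its value \<open>z\<close> at a primitive root \<open>g\<close>, which can be any root of unity of order
  dividing \<open>q - 1\<close>. With \<open>m = (q - 1) / 2\<close>, the power \<open>g ^ m\<close> is \<open>-1\<close> modulo \<open>q\<close>, so the odd characters
  correspond to the solutions of \<open>z ^ m = -1\<close>.
\<close>

lemma card_odd_characters:
  assumes q: "prime q" "odd q"
  shows "card (odd_characters q) = (q - 1) div 2"
proof -
  obtain g where g: "coprime q g" "ord q g = q - 1"
    and gen: "\<And>n. coprime n (int q) \<Longrightarrow> \<exists>i. [int (g ^ i) = n] (mod int q)"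
    using primitive_root_exists[OF q] by blast
  define m where "m = (q - 1) div 2"
  have m: "2 * m = q - 1" "m > 0" using q(2) prime_gt_1_nat[OF q(1)]
    by (auto simp: m_def elim!: oddE)
  note half = primitive_root_half_power[OF q g, folded m_def]
  have "bij_betw (\<lambda>chi. chi (int g)) (odd_characters q) {z. z ^ m = -1}"
    unfolding bij_betw_def
  proof (intro conjI subset_antisym subsetI)
    show "inj_on (\<lambda>chi. chi (int g)) (odd_characters q)"
      using dirichlet_character_determined_by_primitive_root[OF gen]
      by (auto simp: inj_on_def odd_characters_def)
  next
    fix z assume "z \<in> (\<lambda>chi. chi (int g)) ` odd_characters q"
    then obtain chi where chi: "dirichlet_character q chi" "chi (-1) = -1" "z = chi (int g)"
      by (auto simp: odd_characters_def)
    have "z ^ m = chi (int g ^ m)" using dirichlet_character_power[OF chi(1)] chi(3) by simp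
    also have "\<dots> = chi (-1)" using half by (intro dirichlet_character_cong[OF chi(1)]) simp
    finally show "z \<in> {z. z ^ m = -1}" using chi(2) by simp
  next
    fix z :: complex assume "z \<in> {z. z ^ m = -1}"
    hence z: "z ^ m = -1" by simp
    hence z0: "z \<noteq> 0" using m(2) by (auto simp: power_0_left)
    have "z ^ (2 * m) = 1" by (simp add: power_even_eq z)
    hence z1: "z ^ (q - 1) = 1" by (simp only: m(1))
    \<comment> \<open>The discrete logarithm to the base \<open>g\<close>, determined up to multiples of \<open>q - 1\<close>.\<close>
    define idx where "idx = (\<lambda>n. SOME i. [int (g ^ i) = n] (mod int q))"
    define chi where "chi = (\<lambda>n. if coprime n (int q) then z ^ idx n else 0)"
    have idx: "[int (g ^ idx n) = n] (mod int q)" if "coprime n (int q)" for n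
      unfolding idx_def using gen[OF that] by (rule someI_ex)
    have pow_cong: "z ^ i = z ^ j" if "[i = j] (mod q - 1)" for i j
    proof -
      have "z ^ k = z ^ (k mod (q - 1))" for k
      proof -
        have "z ^ ((q - 1) * (k div (q - 1)) + k mod (q - 1)) = z ^ (k mod (q - 1))"
          unfolding power_add power_mult z1 by simp
        thus ?thesis by simp
      qed
      from this[of i] this[of j] that show ?thesis by (simp add: cong_def)
    qed
    have chiI: "chi n = z ^ i" if "[int (g ^ i) = n] (mod int q)" for n i
    proof -
      have "coprime (int (g ^ i)) (int q)" using g(1) by (simp add: coprime_commute)
      hence c: "coprime n (int q)" using that cong_imp_coprime by blast
      have "[int (g ^ idx n) = int (g ^ i)] (mod int q)"
        using idx[OF c] that by (metis cong_sym cong_trans)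
      hence "[g ^ idx n = g ^ i] (mod q)" by (simp only: cong_int_iff)
      hence "[idx n = i] (mod q - 1)" using order_divides_expdiff[OF g(1)] g(2) by simp
      thus ?thesis using c pow_cong by (simp add: chi_def)
    qed
    have "dirichlet_character q chi"
      unfolding dirichlet_character_def
    proof (intro conjI allI)
      fix k n
      show "chi (k * n) = chi k * chi n"
      proof (cases "coprime k (int q) \<and> coprime n (int q)")
        case True
        hence "[int (g ^ idx k) * int (g ^ idx n) = k * n] (mod int q)"
          using idx by (intro cong_mult) auto
        hence "chi (k * n) = z ^ (idx k + idx n)" by (intro chiI) (simp add: power_add)
        thus ?thesis using True by (simp add: chi_def power_add)
      qed (auto simp: chi_def)
    next
      fix n show "chi (n + int q) = chi n"
      proof (cases "coprime n (int q)")
        case True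
        have "[n = n + int q] (mod int q)" by (simp add: cong_def)
        hence "[int (g ^ idx n) = n + int q] (mod int q)" using idx[OF True] cong_trans by blast
        hence "chi (n + int q) = z ^ idx n" by (rule chiI)
        thus ?thesis using True by (simp add: chi_def)
      next
        case False
        have "\<not> coprime (n + int q) (int q)"
          using False unfolding coprime_iff_gcd_eq_1 by (simp only: gcd_add1 not_False_eq_True)
        thus ?thesis using False by (simp add: chi_def)
      qed
    next
      fix n show "(chi n \<noteq> 0) = coprime n (int q)" using z0 by (simp add: chi_def)
    qed
    moreover have "chi (-1) = -1" using chiI[OF half] z by simp
    moreover have "chi (int g) = z" using chiI[of 1 "int g"] by simp
    ultimately show "z \<in> (\<lambda>chi. chi (int g)) ` odd_characters q"
      by (force simp: odd_characters_def)
  qed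
  hence "card (odd_characters q) = card {z :: complex. z ^ m = -1}" by (rule bij_betw_same_card)
  also have "\<dots> = m" using m(2) by (intro card_nth_roots) auto
  finally show ?thesis by (simp add: m_def)
qed

lemma nontrivial_eq_even_Un_odd:
  assumes "q > 0"
  shows "nontrivial_characters q = even_nontrivial_characters q \<union> odd_characters q"
    and "even_nontrivial_characters q \<inter> odd_characters q = {}"
    and "odd_characters q \<subseteq> nontrivial_characters q"
proof -
  show odd: "odd_characters q \<subseteq> nontrivial_characters q"
  proof
    fix chi assume chi: "chi \<in> odd_characters q"
    have "coprime (-1) (int q)" by simp
    hence "principal_character q (-1) = 1" unfolding principal_character_def by (rule if_P)
    moreover have "chi (-1) = -1" using chi by (simp add: odd_characters_def)
    ultimately have "chi \<noteq> principal_character q" by auto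
    thus "chi \<in> nontrivial_characters q"
      using chi by (simp add: nontrivial_characters_def odd_characters_def)
  qed
  have "chi (-1) = 1 \<or> chi (-1) = -1" if "dirichlet_character q chi" for chi
  proof -
    have "chi (-1) ^ 2 = 1"
      using dirichlet_character_mult[OF that, of "-1" "-1"] dirichlet_character_1[OF that]
      by (simp add: power2_eq_square)
    thus ?thesis by (simp add: power2_eq_1_iff)
  qed
  with odd show "nontrivial_characters q = even_nontrivial_characters q \<union> odd_characters q"
    by (auto simp: even_nontrivial_characters_def odd_characters_def nontrivial_characters_def)
  show "even_nontrivial_characters q \<inter> odd_characters q = {}"
    by (auto simp: even_nontrivial_characters_def odd_characters_def)
qed

lemma euler_kronecker_diff:
  assumes "q > 0"
  shows "euler_kronecker q - euler_kronecker_plus q = (\<Sum>chi\<in>odd_characters q. L_logderiv_at_1 chi)"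
proof -
  have "finite (nontrivial_characters q)"
    by (rule finite_subset[OF _ finite_dirichlet_characters[OF assms]])
       (auto simp: nontrivial_characters_def)
  hence "finite (even_nontrivial_characters q)" "finite (odd_characters q)"
    using nontrivial_eq_even_Un_odd(1)[OF assms] by auto
  with nontrivial_eq_even_Un_odd(2)[OF assms] show ?thesis
    unfolding euler_kronecker_def euler_kronecker_plus_def nontrivial_eq_even_Un_odd(1)[OF assms]
    by (subst sum.union_disjoint) auto
qed

section \<open>Non-vanishing at 1 for characters with non-trivial square\<close>

text \<open>
  The product of two absolutely convergent Dirichlet series; the factors \<open>n powr - s\<close> are part of \<open>f\<close> and \<open>g\<close>,
  and the sums start at 1, whence the \<open>Suc\<close>.
\<close>

lemma dirichlet_convolution_sums:
  fixes f g :: "nat \<Rightarrow> complex"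
  assumes f: "summable (\<lambda>n. norm (f (Suc n)))" and g: "summable (\<lambda>n. norm (g (Suc n)))"
  shows "(\<lambda>n. \<Sum>d | d dvd Suc n. f d * g (Suc n div d)) sums ((\<Sum>n. f (Suc n)) * (\<Sum>n. g (Suc n)))"
proof -
  define F G where "F = (\<Sum>n. f (Suc n))" and "G = (\<Sum>n. g (Suc n))"
  have hf: "((\<lambda>n. f (Suc n)) has_sum F) UNIV" and hg: "((\<lambda>n. g (Suc n)) has_sum G) UNIV"
    unfolding F_def G_def
    by (intro norm_summable_imp_has_sum f g summable_sums summable_norm_cancel[OF f]
        summable_norm_cancel[OF g])+
  have nf: "(\<lambda>n. norm (f (Suc n))) summable_on UNIV" and ng: "(\<lambda>n. norm (g (Suc n))) summable_on UNIV"
    by (rule norm_summable_imp_summable_on; simp add: f g)+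
  have "(\<lambda>p. norm (case p of (i, j) \<Rightarrow> f (Suc i) * g (Suc j))) summable_on (UNIV \<times> UNIV)"
  proof (rule iffD2[OF Infinite_Sum.abs_summable_on_Sigma_iff[where f = "\<lambda>(i, j). f (Suc i) * g (Suc j)" and A = UNIV and B = "\<lambda>_. UNIV"]], intro conjI ballI)
    show "(\<lambda>j. norm (case (i, j) of (i, j) \<Rightarrow> f (Suc i) * g (Suc j))) summable_on UNIV" for i
      using summable_on_cmult_right[OF ng] by (simp add: norm_mult)
    show "(\<lambda>i. norm (\<Sum>\<^sub>\<infinity>j. norm (case (i, j) of (i, j) \<Rightarrow> f (Suc i) * g (Suc j)))) summable_on UNIV"
      using summable_on_cmult_left[OF nf]
      by (simp add: norm_mult infsum_cmult_right' abs_mult infsum_nonneg)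
  qed
  hence sm: "(\<lambda>(i, j). f (Suc i) * g (Suc j)) summable_on (UNIV \<times> UNIV)"
    by (rule Infinite_Sum.abs_summable_summable)
  have "((\<lambda>(i, j). f (Suc i) * g (Suc j)) has_sum F * G) (UNIV \<times> UNIV)"
  proof (rule has_sum_SigmaI[OF _ _ sm])
    show "((\<lambda>j. case (i, j) of (i, j) \<Rightarrow> f (Suc i) * g (Suc j)) has_sum f (Suc i) * G) UNIV" for i
      using has_sum_cmult_right[OF hg] by simp
    show "((\<lambda>i. f (Suc i) * G) has_sum F * G) UNIV"
      by (rule has_sum_cmult_left[OF hf])
  qed
  also have "?this \<longleftrightarrow> ((\<lambda>(n, d). f d * g (Suc n div d)) has_sum F * G) (Sigma UNIV (\<lambda>n. {d. d dvd Suc n}))"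
  proof (rule has_sum_reindex_bij_witness
      [where i = "\<lambda>(n, d). (d - 1, Suc n div d - 1)" and j = "\<lambda>(i, j). (Suc i * Suc j - 1, Suc i)"])
    fix b assume "b \<in> Sigma UNIV (\<lambda>n. {d. d dvd Suc n})"
    then obtain n d k where b: "b = (n, d)" "Suc n = d * k" by (auto simp: dvd_def)
    hence "d > 0" "k > 0" by (auto intro!: Nat.gr0I)
    hence "Suc n div d = k" "Suc (d - 1) = d" "Suc (k - 1) = k" using b(2) by auto
    thus "(case case b of (n, d) \<Rightarrow> (d - 1, Suc n div d - 1) of (i, j) \<Rightarrow> (Suc i * Suc j - 1, Suc i)) = b"
      using b(2)[symmetric] by (simp add: b(1) del: mult_Suc mult_Suc_right)
  next
    fix a :: "nat \<times> nat"
    obtain i j where a: "a = (i, j)" by fastforce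
    have *: "Suc (Suc i * Suc j - 1) = Suc i * Suc j" by simp
    show "(case case a of (i, j) \<Rightarrow> (Suc i * Suc j - 1, Suc i) of (n, d) \<Rightarrow> (d - 1, Suc n div d - 1)) = a"
      unfolding a prod.case * by (simp del: mult_Suc mult_Suc_right)
    show "(case a of (i, j) \<Rightarrow> (Suc i * Suc j - 1, Suc i)) \<in> Sigma UNIV (\<lambda>n. {d. d dvd Suc n})"
      unfolding a prod.case mem_Sigma_iff mem_Collect_eq * by (intro conjI UNIV_I dvd_triv_left)
    show "(case case a of (i, j) \<Rightarrow> (Suc i * Suc j - 1, Suc i) of (n, d) \<Rightarrow> f d * g (Suc n div d)) =
          (case a of (i, j) \<Rightarrow> f (Suc i) * g (Suc j))"
      unfolding a prod.case * by (simp del: mult_Suc mult_Suc_right)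
  qed auto
  finally have "((\<lambda>n. \<Sum>d | d dvd Suc n. f d * g (Suc n div d)) has_sum F * G) UNIV"
    by (rule has_sum_SigmaD) (auto intro!: has_sum_finiteI)
  thus ?thesis unfolding F_def G_def by (rule has_sum_imp_sums)
qed

lemma summable_Suc_powr:
  assumes "s > (1::real)"
  shows "summable (\<lambda>n. real (Suc n) powr - s)"
  using assms summable_real_powr_iff[of "-s"] by (subst summable_Suc_iff) simp

lemma summable_ln_powr:
  assumes "s > (1::real)"
  shows "summable (\<lambda>n. ln (real (Suc n)) * real (Suc n) powr - s)"
proof (rule summable_comparison_test')
  define h where "h = (s - 1) / 2"
  have h: "h > 0" using assms by (simp add: h_def)
  show "summable (\<lambda>n. real (Suc n) powr - (s - h) / h)"
    using assms by (intro summable_divide summable_Suc_powr) (simp add: h_def field_simps)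
  fix n :: nat
  have "ln (real (Suc n)) \<le> real (Suc n) powr h / h" using h by (intro ln_powr_bound) auto
  hence "ln (real (Suc n)) * real (Suc n) powr - s \<le> real (Suc n) powr h / h * real (Suc n) powr - s"
    by (intro mult_right_mono) auto
  also have "\<dots> = real (Suc n) powr - (s - h) / h"
    by (simp add: powr_add[symmetric] del: of_nat_Suc)
  finally show "norm (ln (real (Suc n)) * real (Suc n) powr - s) \<le> real (Suc n) powr - (s - h) / h"
    by (simp del: of_nat_Suc)
qed

text \<open>
  The Dirichlet series of \<open>chi\<close> times the von Mangoldt function at a real point \<open>s > 1\<close>. Where the L-function
  of \<open>chi\<close> does not vanish, it is minus its logarithmic derivative.
\<close>

definition mangoldt_series :: "(int \<Rightarrow> complex) \<Rightarrow> real \<Rightarrow> complex" where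
  "mangoldt_series chi s =
     (\<Sum>n. chi (int (Suc n)) * of_real (mangoldt (Suc n) * real (Suc n) powr - s))"

lemma summable_norm_mangoldt_series:
  assumes "\<And>n. norm (chi n :: complex) \<le> 1" "s > 1"
  shows "summable (\<lambda>n. norm (chi (int (Suc n)) * of_real (mangoldt (Suc n) * real (Suc n) powr - s)))"
proof (rule summable_comparison_test'[OF summable_ln_powr[OF assms(2)]])
  fix n
  have "norm (chi (int (Suc n)) * of_real (mangoldt (Suc n) * real (Suc n) powr - s))
      \<le> 1 * (mangoldt (Suc n) * real (Suc n) powr - s)"
    unfolding norm_mult norm_of_real abs_mult abs_mangoldt
    by (intro mult_mono assms(1) mult_nonneg_nonneg mangoldt_nonneg) auto
  also have "\<dots> \<le> ln (real (Suc n)) * real (Suc n) powr - s"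
    using mangoldt_le[of "Suc n"] by (simp add: mult_right_mono del: of_nat_Suc)
  finally show "norm (norm (chi (int (Suc n)) * of_real (mangoldt (Suc n) * real (Suc n) powr - s)))
      \<le> ln (real (Suc n)) * real (Suc n) powr - s" by (simp only: real_norm_def abs_norm_cancel)
qed

lemma summable_norm_character_series:
  assumes "\<And>n. norm (chi n :: complex) \<le> 1" "s > 1"
  shows "summable (\<lambda>n. norm (chi (int (Suc n)) * of_real (real (Suc n) powr - s)))"
proof (rule summable_comparison_test'[OF summable_Suc_powr[OF assms(2)]])
  fix n
  show "norm (norm (chi (int (Suc n)) * of_real (real (Suc n) powr - s))) \<le> real (Suc n) powr - s"
    using mult_right_mono[OF assms(1)[of "int (Suc n)"], of "real (Suc n) powr - s"]
    by (simp add: norm_mult del: of_nat_Suc)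
qed

lemma mangoldt_series_mult:
  assumes mult: "\<And>m n. chi (m * n) = chi m * chi n" and norm: "\<And>n. norm (chi n :: complex) \<le> 1"
    and s: "s > 1"
  shows "mangoldt_series chi s * (\<Sum>n. chi (int (Suc n)) * of_real (real (Suc n) powr - s)) =
    (\<Sum>n. chi (int (Suc n)) * of_real (ln (real (Suc n)) * real (Suc n) powr - s))"
proof -
  define f where "f = (\<lambda>n. chi (int n) * of_real (mangoldt n * real n powr - s))"
  define g where "g = (\<lambda>n. chi (int n) * of_real (real n powr - s))"
  have "(\<Sum>d | d dvd Suc n. f d * g (Suc n div d)) =
      chi (int (Suc n)) * of_real (ln (real (Suc n)) * real (Suc n) powr - s)" for n
  proof -
    have "f d * g (Suc n div d) =
        chi (int (Suc n)) * of_real (mangoldt d * real (Suc n) powr - s)" if d: "d dvd Suc n" for d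
    proof -
      obtain k where k: "Suc n = d * k" using d by (auto simp: dvd_def)
      hence "d > 0" "k > 0" by (auto intro!: Nat.gr0I)
      thus ?thesis unfolding f_def g_def k by (simp add: mult powr_mult)
    qed
    hence "(\<Sum>d | d dvd Suc n. f d * g (Suc n div d)) =
        (\<Sum>d | d dvd Suc n. chi (int (Suc n)) * of_real (mangoldt d * real (Suc n) powr - s))"
      by (intro sum.cong) auto
    also have "\<dots> = chi (int (Suc n)) * of_real ((\<Sum>d | d dvd Suc n. mangoldt d) * real (Suc n) powr - s)"
      by (simp only: sum_distrib_left sum_distrib_right of_real_sum)
    finally show ?thesis by (simp only: mangoldt_sum[OF Suc_not_Zero] of_real_of_nat_eq id_apply of_real_eq_id)
  qed
  moreover have "(\<lambda>n. \<Sum>d | d dvd Suc n. f d * g (Suc n div d)) sums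
      ((\<Sum>n. f (Suc n)) * (\<Sum>n. g (Suc n)))"
    unfolding f_def g_def
    by (intro dirichlet_convolution_sums summable_norm_mangoldt_series summable_norm_character_series norm s)
  ultimately show ?thesis
    unfolding mangoldt_series_def f_def g_def by (simp only: sums_iff)
qed

lemma dirichlet_L_of_real:
  assumes "s > 1"
  shows "dirichlet_L chi (of_real s) = (\<Sum>n. chi (int (Suc n)) * of_real (real (Suc n) powr - s))"
proof -
  have "chi (int (Suc n)) / of_nat (Suc n) powr of_real s =
      chi (int (Suc n)) * of_real (real (Suc n) powr - s)" for n
  proof -
    have "(of_nat (Suc n) :: complex) powr of_real s = of_real (real (Suc n) powr s)"
      using powr_of_real[of "real (Suc n)" s] by simp
    thus ?thesis by (simp add: powr_minus divide_inverse del: of_nat_Suc)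
  qed
  thus ?thesis unfolding dirichlet_L_def by simp
qed

lemma deriv_dirichlet_L_of_real:
  assumes chi: "chi \<in> nontrivial_characters q" "q > 0" and s: "s > 1"
  shows "deriv (dirichlet_L chi) (of_real s) =
    - (\<Sum>n. chi (int (Suc n)) * of_real (ln (real (Suc n)) * real (Suc n) powr - s))"
proof -
  have norm: "norm (chi n) \<le> 1" for n
    using chi dirichlet_character_norm_le_1 by (auto simp: nontrivial_characters_def)
  define f where "f = (\<lambda>n z. chi (int (Suc n)) * of_nat (Suc n) powr - z)"
  define f' where "f' = (\<lambda>n z. chi (int (Suc n)) * (- ln (of_nat (Suc n)) * of_nat (Suc n) powr - z))"
  have "\<exists>g g'. \<forall>z\<in>{z. Re z > 1}. (\<lambda>n. f n z) sums g z \<and> (\<lambda>n. f' n z) sums g' z \<and>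
          (g has_field_derivative g' z) (at z)"
  proof (rule series_and_derivative_comparison_local)
    show "open {z. Re z > 1}" by (rule open_halfspace_Re_gt)
    fix n z
    have "((\<lambda>z. of_nat (Suc n) powr z :: complex) has_field_derivative
            ln (of_nat (Suc n)) * of_nat (Suc n) powr (-z)) (at (-z))"
      by (rule has_field_derivative_powr_right) (simp del: of_nat_Suc)
    from DERIV_cmult[OF DERIV_chain2[OF this DERIV_minus[OF DERIV_ident]]]
    show "(f n has_field_derivative f' n z) (at z)"
      unfolding f_def f'_def by simp
  next
    fix z :: complex assume "z \<in> {z. Re z > 1}"
    define d where "d = (Re z - 1) / 2"
    have d: "d > 0" "Re z = 1 + 2 * d" using \<open>z \<in> _\<close> by (auto simp: d_def field_simps)
    have "norm (f n t) \<le> real (Suc n) powr - (1 + d)" if "t \<in> ball z d" for n t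
    proof -
      have "Re z - Re t \<le> norm (z - t)" using abs_Re_le_cmod[of "z - t"] by simp
      hence t: "Re t \<ge> 1 + d" using that d(2) by (simp add: dist_norm)
      have "norm (f n t) \<le> 1 * real (Suc n) powr - Re t"
        unfolding f_def norm_mult
        by (intro mult_mono norm) (auto simp: norm_powr_real_powr simp del: of_nat_Suc)
      also have "\<dots> \<le> 1 * real (Suc n) powr - (1 + d)" using t by (intro mult_left_mono powr_mono) auto
      finally show ?thesis by simp
    qed
    with d(1) summable_Suc_powr[of "1 + d"]
    show "\<exists>d h. 0 < d \<and> summable h \<and>
        (\<forall>\<^sub>F n in sequentially. \<forall>y\<in>ball z d \<inter> {z. Re z > 1}. norm (f n y) \<le> h n)"
      by (intro exI[of _ d] exI[of _ "\<lambda>n. real (Suc n) powr - (1 + d)"]) auto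
  qed
  then obtain g g' where g: "\<And>z. Re z > 1 \<Longrightarrow> (\<lambda>n. f n z) sums g z"
    "\<And>z. Re z > 1 \<Longrightarrow> (\<lambda>n. f' n z) sums g' z"
    "\<And>z. Re z > 1 \<Longrightarrow> (g has_field_derivative g' z) (at z)" by blast
  have f': "f' n (of_real s) =
      - (chi (int (Suc n)) * of_real (ln (real (Suc n)) * real (Suc n) powr - s))" for n
  proof -
    have "(of_nat (Suc n) :: complex) powr - of_real s = of_real (real (Suc n) powr - s)"
      using powr_of_real[of "real (Suc n)" "-s"] by simp
    moreover have "ln (of_nat (Suc n) :: complex) = of_real (ln (real (Suc n)))"
      using Ln_of_real[of "real (Suc n)"] by simp
    ultimately show ?thesis unfolding f'_def by (simp del: of_nat_Suc)
  qed
  have "g z = dirichlet_L chi z" if "z \<in> {z. Re z > 1}" for z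
    using g(1)[of z] that unfolding dirichlet_L_def f_def
    by (simp add: sums_iff powr_minus divide_inverse del: of_nat_Suc)
  hence "(dirichlet_L chi has_field_derivative g' (of_real s)) (at (of_real s))"
    using s by (intro has_field_derivative_transform_within_open[OF g(3), of _ "{z. Re z > 1}"])
      (auto simp: open_halfspace_Re_gt)
  hence "deriv (dirichlet_L chi) (of_real s) = g' (of_real s)" by (rule DERIV_imp_deriv)
  also have "\<dots> = (\<Sum>n. f' n (of_real s))" using g(2)[of "of_real s"] s by (simp add: sums_iff)
  also have "\<dots> = (\<Sum>n. - (chi (int (Suc n)) * complex_of_real (ln (real (Suc n)) * real (Suc n) powr - s)))"
    by (rule suminf_cong) (rule f')
  also have "(\<Sum>n. - (chi (int (Suc n)) * complex_of_real (ln (real (Suc n)) * real (Suc n) powr - s))) =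
      - (\<Sum>n. chi (int (Suc n)) * of_real (ln (real (Suc n)) * real (Suc n) powr - s))"
  proof (rule suminf_minus, rule summable_norm_cancel, rule summable_comparison_test'[OF summable_ln_powr[OF s]])
    fix n
    show "norm (norm (chi (int (Suc n)) * of_real (ln (real (Suc n)) * real (Suc n) powr - s)))
        \<le> ln (real (Suc n)) * real (Suc n) powr - s"
      using mult_right_mono[OF norm[of "int (Suc n)"], of "ln (real (Suc n)) * real (Suc n) powr - s"]
      by (simp add: norm_mult abs_mult del: of_nat_Suc)
  qed
  finally show ?thesis .
qed

text \<open>
  The residue of the logarithmic derivative of \<open>f\<close> at \<open>z\<close> is the order of vanishing \<open>m\<close>.
\<close>

lemma logderiv_limit:
  assumes f: "f holomorphic_on S" "open S" "connected S" "z \<in> S" and nz: "\<exists>w\<in>S. f w \<noteq> 0"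
  obtains m :: nat where "m = 0 \<longleftrightarrow> f z \<noteq> 0"
    "((\<lambda>w. (w - z) * deriv f w / f w) \<longlongrightarrow> of_nat m) (at z)"
    "eventually (\<lambda>w. f w \<noteq> 0) (at z)"
proof -
  define n where "n = nat (zorder f z)"
  define g where "g = zor_poly f z"
  \<comment> \<open>Near the point, \<open>f w\<close> is a power of \<open>w - z\<close> times a non-vanishing factor.\<close>
  from zorder_exist_zero[OF f nz] obtain r where
    r: "if f z = 0 then zorder f z > 0 else zorder f z = 0" "r > 0" "cball z r \<subseteq> S"
      "g holomorphic_on cball z r" and fg: "\<And>w. w \<in> cball z r \<Longrightarrow> f w = g w * (w - z) ^ n \<and> g w \<noteq> 0"
    unfolding g_def n_def by blast
  have gh: "g holomorphic_on ball z r" by (rule holomorphic_on_subset[OF r(4)]) auto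
  have dg: "(g has_field_derivative deriv g w) (at w)" if "w \<in> ball z r" for w
    using gh that by (intro holomorphic_derivI[of g "ball z r"]) auto
  have ev: "eventually (\<lambda>w. w \<in> ball z r - {z}) (at z)"
    using r(2) by (intro eventually_at_in_open) auto
  have eq: "(w - z) * deriv f w / f w = (w - z) * deriv g w / g w + of_nat n"
    if w: "w \<in> ball z r - {z}" for w
  proof -
    have "((\<lambda>w. g w * (w - z) ^ n) has_field_derivative
        deriv g w * (w - z) ^ n + g w * (of_nat n * (w - z) ^ (n - 1))) (at w)"
      using w by (auto intro!: derivative_eq_intros dg)
    hence "(f has_field_derivative deriv g w * (w - z) ^ n + g w * (of_nat n * (w - z) ^ (n - 1))) (at w)"
      using w fg by (intro has_field_derivative_transform_within_open[of _ _ _ "ball z r" f]) auto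
    hence "deriv f w = deriv g w * (w - z) ^ n + g w * (of_nat n * (w - z) ^ (n - 1))"
      by (rule DERIV_imp_deriv)
    moreover have "f w = g w * (w - z) ^ n" "g w \<noteq> 0" "w - z \<noteq> 0" using w fg[of w] by auto
    moreover have "u * (G' * u ^ n + G * (of_nat n * u ^ (n - 1))) / (G * u ^ n) = u * G' / G + of_nat n"
      if "u \<noteq> 0" "G \<noteq> 0" for u G G' :: complex
      using that by (cases n) (auto simp: field_simps)
    ultimately show ?thesis by (simp only: not_False_eq_True)
  qed
  show ?thesis
  proof (rule that[of n])
    show "n = 0 \<longleftrightarrow> f z \<noteq> 0" using r(1) by (auto simp: n_def split: if_splits)
    have "isCont g z" "isCont (deriv g) z"
      using gh r(2) by (auto intro!: holomorphic_on_imp_continuous_on[THEN continuous_on_interior]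
          holomorphic_deriv[of _ "ball z r"])
    moreover have "g z \<noteq> 0" using fg[of z] r(2) by auto
    ultimately have "((\<lambda>w. (w - z) * deriv g w / g w + of_nat n) \<longlongrightarrow> (z - z) * deriv g z / g z + of_nat n) (at z)"
      by (intro tendsto_intros) (auto simp: isCont_def)
    hence "((\<lambda>w. (w - z) * deriv g w / g w + of_nat n) \<longlongrightarrow> of_nat n) (at z)" by simp
    moreover have "eventually (\<lambda>w. (w - z) * deriv g w / g w + of_nat n = (w - z) * deriv f w / f w) (at z)"
      using ev by eventually_elim (simp add: eq)
    ultimately show "((\<lambda>w. (w - z) * deriv f w / f w) \<longlongrightarrow> of_nat n) (at z)"
      by (rule Lim_transform_eventually)
    show "eventually (\<lambda>w. f w \<noteq> 0) (at z)"
      using ev by eventually_elim (use fg in auto)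
  qed
qed

text \<open>
  Comparison of the zeta series with the integral of the same power function.
\<close>

lemma zeta_bounds:
  assumes d: "d > (0::real)"
  shows "1 / d \<le> (\<Sum>n. real (Suc n) powr - (1 + d))" (is ?A)
    and "(\<Sum>n. real (Suc (Suc n)) powr - (1 + d)) \<le> 1 / d" (is ?B)
    and "(\<Sum>n. real (Suc n) powr - (1 + d)) \<le> 1 + 1 / d" (is ?C)
proof -
  \<comment> \<open>An antiderivative of the terms, so that its increments telescope.\<close>
  define F where "F = (\<lambda>n. - (real (Suc n) powr - d) / d)"
  have "F \<longlonglongrightarrow> - 0 / d" unfolding F_def
    using d by (intro tendsto_intros tendsto_neg_powr filterlim_compose[OF filterlim_real_sequentially]
            filterlim_Suc) auto
  hence F: "(\<lambda>n. F (Suc n) - F n) sums (0 - F 0)" using telescope_sums[of F 0] by simp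
  have F0: "0 - F 0 = 1 / d" by (simp add: F_def)
  have step: "F (Suc n) - F n \<le> real (Suc n) powr - (1 + d)"
    "real (Suc (Suc n)) powr - (1 + d) \<le> F (Suc n) - F n" for n
  proof -
    have "\<exists>z. z > real (Suc n) \<and> z < real (Suc (Suc n)) \<and>
        (\<lambda>x. - (x powr - d) / d) (real (Suc (Suc n))) - (\<lambda>x. - (x powr - d) / d) (real (Suc n)) =
        (real (Suc (Suc n)) - real (Suc n)) * z powr - (1 + d)"
    proof (rule MVT2)
      fix x assume x: "real (Suc n) \<le> x"
      hence "x > 0" by simp
      have "((\<lambda>x. - (x powr - d) / d) has_real_derivative - (- d * x powr (- d - 1)) / d) (at x)"
        using \<open>x > 0\<close> d by (auto intro!: derivative_eq_intros)
      moreover have "- (- d * x powr (- d - 1)) / d = x powr - (1 + d)"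
      proof -
        have e: "- (1 + d) = - d - 1" by simp
        show ?thesis using d unfolding e by simp
      qed
      ultimately show "((\<lambda>x. - (x powr - d) / d) has_real_derivative x powr - (1 + d)) (at x)"
        by (simp only:)
    qed simp
    then obtain z where z: "z > real (Suc n)" "z < real (Suc (Suc n))"
      "F (Suc n) - F n = z powr - (1 + d)" by (auto simp: F_def)
    show "F (Suc n) - F n \<le> real (Suc n) powr - (1 + d)"
      "real (Suc (Suc n)) powr - (1 + d) \<le> F (Suc n) - F n"
      unfolding z(3) using z(1,2) d by (intro powr_mono2'; simp)+
  qed
  have sm: "summable (\<lambda>n. real (Suc n) powr - (1 + d))" using d by (intro summable_Suc_powr) auto
  hence sm': "summable (\<lambda>n. real (Suc (Suc n)) powr - (1 + d))"
    by (subst summable_Suc_iff)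
  show ?A using suminf_le[OF step(1) sums_summable[OF F] sm] F F0 by (simp add: sums_iff)
  show B: ?B using suminf_le[OF step(2) sm' sums_summable[OF F]] F F0 by (simp add: sums_iff)
  show ?C using B suminf_split_head[OF sm] by simp
qed

text \<open>
  An upper bound for \<open>- \<zeta>'/\<zeta>(1 + d)\<close> which is close enough to \<open>1/d\<close> for the inequality 3-4-1, where
  \<open>(10/9)/d\<close> may replace \<open>1/d\<close> because \<open>3 * 10/9 < 4\<close>. It needs no derivative of the zeta function:
  \<open>log n \<le> (n powr h - 1) / h\<close> bounds \<open>- \<zeta>'(1 + d)\<close> by a difference quotient of \<open>\<zeta>\<close>.
\<close>

lemma mangoldt_zeta_bound:
  assumes d: "d > (0::real)"
  shows "d * (\<Sum>n. mangoldt (Suc n) * real (Suc n) powr - (1 + d)) \<le> 10 / 9 + 10 * d"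
proof -
  define Z where "Z = (\<lambda>d. \<Sum>n. real (Suc n) powr - (1 + d))"
  define V where "V = (\<Sum>n. mangoldt (Suc n) * real (Suc n) powr - (1 + d))"
  define M where "M = (\<Sum>n. ln (real (Suc n)) * real (Suc n) powr - (1 + d))"
  \<comment> \<open>Any fraction of \<open>d\<close> below 1/4 gives a constant below 4/3 in the final bound.\<close>
  define h where "h = d / 10"
  have h: "h > 0" "d - h > 0" "h = d / 10" "d - h = 9 / 10 * d" using d by (auto simp: h_def)
  note sm = summable_Suc_powr[of "1 + d"] summable_Suc_powr[of "1 + (d - h)"] summable_ln_powr[of "1 + d"]
  have V: "V * Z d = M"
  proof -
    have "of_real V = mangoldt_series (\<lambda>_. 1) (1 + d)"
      using summable_norm_mangoldt_series[of "\<lambda>_. 1" "1 + d"] d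
      unfolding V_def mangoldt_series_def
      by (subst suminf_of_real) (auto simp: norm_mult intro: summable_norm_cancel)
    moreover have "of_real (Z d) = (\<Sum>n. 1 * complex_of_real (real (Suc n) powr - (1 + d)))"
      unfolding Z_def using sm(1) d by (subst suminf_of_real) auto
    moreover have "of_real M = (\<Sum>n. 1 * complex_of_real (ln (real (Suc n)) * real (Suc n) powr - (1 + d)))"
      unfolding M_def using sm(3) d by (subst suminf_of_real) auto
    ultimately have "complex_of_real (V * Z d) = of_real M"
      using mangoldt_series_mult[of "\<lambda>_. 1" "1 + d"] d by simp
    thus ?thesis by (simp only: of_real_eq_iff)
  qed
  have "M \<le> (\<Sum>n. (real (Suc n) powr - (1 + (d - h)) - real (Suc n) powr - (1 + d)) / h)"
    unfolding M_def
  proof (rule suminf_le)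
    fix n
    define x where "x = real (Suc n)"
    have x: "x > 0" by (simp add: x_def)
    have "h * ln x \<le> x powr h - 1"
    proof -
      have "1 + h * ln x \<le> exp (h * ln x)" by (rule exp_ge_add_one_self)
      moreover have "exp (h * ln x) = x powr h" using x by (simp add: powr_def)
      ultimately show ?thesis by linarith
    qed
    hence "ln x \<le> (x powr h - 1) / h" using h(1) by (simp add: field_simps)
    hence "ln x * x powr - (1 + d) \<le> (x powr h - 1) / h * x powr - (1 + d)"
      by (intro mult_right_mono) auto
    also have "\<dots> = (x powr h * x powr - (1 + d) - x powr - (1 + d)) / h"
      by (simp add: algebra_simps diff_divide_distrib)
    also have "x powr h * x powr - (1 + d) = x powr - (1 + (d - h))"
      by (simp add: powr_add[symmetric] algebra_simps)
    finally show "ln x * x powr - (1 + d) \<le> (x powr - (1 + (d - h)) - x powr - (1 + d)) / h" .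
  qed (use sm d h in \<open>auto intro!: summable_divide summable_diff\<close>)
  also have "\<dots> = (Z (d - h) - Z d) / h"
    unfolding Z_def using sm d h by (simp add: suminf_divide suminf_diff summable_diff)
  also have "\<dots> \<le> (1 + 1 / (d - h) - 1 / d) / h"
    using zeta_bounds(3)[of "d - h"] zeta_bounds(1)[of d] d h(1,2)
    unfolding Z_def by (intro divide_right_mono) auto
  also have "\<dots> = 10 / d + 10 / (9 * d\<^sup>2)"
    unfolding h(4) using d by (simp add: h(3) field_simps power2_eq_square)
  finally have M: "M \<le> 10 / d + 10 / (9 * d\<^sup>2)" .
  have "V \<ge> 0" unfolding V_def
    using summable_norm_mangoldt_series[of "\<lambda>_. 1" "1 + d"] d
    by (intro suminf_nonneg) (auto simp: norm_mult abs_mult intro!: mult_nonneg_nonneg mangoldt_nonneg)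
  hence "V * (1 / d) \<le> V * Z d"
    using zeta_bounds(1)[OF d] unfolding Z_def by (intro mult_left_mono) auto
  hence "V * (1 / d) \<le> 10 / d + 10 / (9 * d\<^sup>2)" using V M by linarith
  hence "d * (V * (1 / d)) \<le> d * (10 / d + 10 / (9 * d\<^sup>2))" using d by (intro mult_left_mono) auto
  hence "V \<le> d * (10 / d + 10 / (9 * d\<^sup>2))" using d by simp
  hence "d * V \<le> d * (d * (10 / d + 10 / (9 * d\<^sup>2)))" using d by (intro mult_left_mono) auto
  also have "\<dots> = 10 / 9 + 10 * d" using d by (simp add: field_simps power2_eq_square)
  finally show ?thesis unfolding V_def .
qed

text \<open>
  At 3 the first term 1 of the series outweighs the rest. This rules out an L-function that vanishes
  identically, so that the order of vanishing at 1 is finite.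
\<close>

lemma dirichlet_L_nonzero_at_3:
  assumes chi: "chi \<in> nontrivial_characters q" "q > 0"
  shows "dirichlet_L chi 3 \<noteq> 0"
proof
  assume 0: "dirichlet_L chi 3 = 0"
  have ch: "dirichlet_character q chi" using chi by (auto simp: nontrivial_characters_def)
  note norm = dirichlet_character_norm_le_1[OF ch chi(2)]
  define f where "f = (\<lambda>n. chi (int (Suc n)) * of_real (real (Suc n) powr - 3))"
  have sm: "summable (\<lambda>n. norm (f n))" unfolding f_def by (intro summable_norm_character_series norm) simp
  hence sm': "summable (\<lambda>n. norm (f (Suc n)))" by (subst summable_Suc_iff)
  have "(\<Sum>n. f n) = 0" using dirichlet_L_of_real[of 3 chi] 0 by (simp add: f_def)
  moreover have "(\<Sum>n. f n) = f 0 + (\<Sum>n. f (Suc n))"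
    using suminf_split_head[OF summable_norm_cancel[OF sm]] by simp
  moreover have "f 0 = 1" using dirichlet_character_1[OF ch] by (simp add: f_def)
  ultimately have "(\<Sum>n. f (Suc n)) = - 1" by (simp add: eq_neg_iff_add_eq_0 add.commute)
  hence "1 = norm (\<Sum>n. f (Suc n))" by simp
  also have "\<dots> \<le> (\<Sum>n. norm (f (Suc n)))" by (rule summable_norm[OF sm'])
  also have "\<dots> \<le> (\<Sum>n. real (Suc (Suc n)) powr - (1 + 2))"
  proof (rule suminf_le[OF _ sm'])
    have "summable (\<lambda>n. real (Suc n) powr - (1 + 2))" by (rule summable_Suc_powr) simp
    thus "summable (\<lambda>n. real (Suc (Suc n)) powr - (1 + 2))" by (subst summable_Suc_iff)
    show "norm (f (Suc n)) \<le> real (Suc (Suc n)) powr - (1 + 2)" for n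
      using mult_right_mono[OF norm[of "int (Suc (Suc n))"], of "real (Suc (Suc n)) powr - 3"]
      by (simp add: f_def norm_mult del: of_nat_Suc)
  qed
  also have "\<dots> \<le> 1 / 2" by (rule zeta_bounds(2)) simp
  finally show False by simp
qed

lemma mangoldt_series_pole_order:
  assumes chi: "chi \<in> nontrivial_characters q" "q > 0"
  obtains m :: nat where "m = 0 \<longleftrightarrow> dirichlet_L chi 1 \<noteq> 0"
    "((\<lambda>s. (s - 1) * Re (mangoldt_series chi s)) \<longlongrightarrow> - real m) (at_right 1)"
proof -
  have ch: "dirichlet_character q chi" using chi by (auto simp: nontrivial_characters_def)
  have conn: "connected {s. Re s > 0}" by (intro convex_connected convex_halfspace_Re_gt)
  have nz: "\<exists>w\<in>{s. Re s > 0}. dirichlet_L chi w \<noteq> 0"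
    using dirichlet_L_nonzero_at_3[OF chi] by (intro bexI[of _ 3]) auto
  obtain m where m: "m = 0 \<longleftrightarrow> dirichlet_L chi 1 \<noteq> 0"
    "((\<lambda>w. (w - 1) * deriv (dirichlet_L chi) w / dirichlet_L chi w) \<longlongrightarrow> of_nat m) (at 1)"
    "eventually (\<lambda>w. dirichlet_L chi w \<noteq> 0) (at 1)"
    by (rule logderiv_limit[OF dirichlet_L_holomorphic[OF chi] open_halfspace_Re_gt conn _ nz, of 1])
       (simp, rule that)
  have lim: "filterlim complex_of_real (at 1) (at_right 1)"
    unfolding filterlim_at
    by (auto intro!: tendsto_eq_intros eventually_at_right_less simp: eventually_at_filter)
  have "((\<lambda>s. - Re ((of_real s - 1) * deriv (dirichlet_L chi) (of_real s) / dirichlet_L chi (of_real s)))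
      \<longlongrightarrow> - Re (of_nat m)) (at_right 1)"
    by (intro tendsto_intros filterlim_compose[OF m(2) lim])
  moreover have "eventually (\<lambda>s. - Re ((of_real s - 1) * deriv (dirichlet_L chi) (of_real s) / dirichlet_L chi (of_real s))
      = (s - 1) * Re (mangoldt_series chi s)) (at_right 1)"
    using filterlim_iff[THEN iffD1, OF lim, rule_format, OF m(3)] eventually_at_right_less[of 1]
  proof eventually_elim
    case (elim s)
    have "mangoldt_series chi s * dirichlet_L chi (of_real s) = - deriv (dirichlet_L chi) (of_real s)"
      unfolding dirichlet_L_of_real[OF elim(2)] deriv_dirichlet_L_of_real[OF chi elim(2)] minus_minus
      by (rule mangoldt_series_mult[OF dirichlet_character_mult[OF ch]
            dirichlet_character_norm_le_1[OF ch chi(2)] elim(2)])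
    hence "deriv (dirichlet_L chi) (of_real s) = - mangoldt_series chi s * dirichlet_L chi (of_real s)"
      by simp
    moreover have "of_real s - 1 = complex_of_real (s - 1)" by simp
    ultimately show ?case using elim by (simp del: of_real_diff)
  qed
  ultimately have "((\<lambda>s. (s - 1) * Re (mangoldt_series chi s)) \<longlongrightarrow> - Re (of_nat m)) (at_right 1)"
    by (rule Lim_transform_eventually)
  thus ?thesis using m(1) by (intro that[of m]) auto
qed

text \<open>
  If \<open>m\<close> and \<open>k\<close> are the orders of vanishing at 1 of the L-functions of \<open>chi\<close> and of its square, the inequality
  gives \<open>4 m + k \<le> 10/3\<close> in the limit, so \<open>m = 0\<close>.
\<close>

lemma dirichlet_L_nonzero_complex:
  assumes chi: "chi \<in> nontrivial_characters q" "q > 0"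
    and chi2: "(\<lambda>n. chi n ^ 2) \<in> nontrivial_characters q"
  shows "dirichlet_L chi 1 \<noteq> 0"
proof -
  define psi where "psi = (\<lambda>n. chi n ^ 2)"
  note chi2 = chi2[folded psi_def]
  have norm: "norm (chi n) \<le> 1" "norm (psi n) \<le> 1" for n
    using chi chi2 dirichlet_character_norm_le_1 by (auto simp: nontrivial_characters_def)
  obtain m where m: "m = 0 \<longleftrightarrow> dirichlet_L chi 1 \<noteq> 0"
    "((\<lambda>s. (s - 1) * Re (mangoldt_series chi s)) \<longlongrightarrow> - real m) (at_right 1)"
    using mangoldt_series_pole_order[OF chi] by blast
  obtain k :: nat where k: "((\<lambda>s. (s - 1) * Re (mangoldt_series psi s)) \<longlongrightarrow> - real k) (at_right 1)"
    using mangoldt_series_pole_order[OF chi2 chi(2)] by blast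
  have ineq: "0 \<le> 3 + 4 * Re z + Re (z ^ 2)" if "norm z \<le> 1" for z
  proof -
    have "(Re z)\<^sup>2 + (Im z)\<^sup>2 \<le> 1" using that by (simp add: cmod_def)
    hence "3 + 4 * Re z + Re (z ^ 2) \<ge> 2 * (1 + Re z)\<^sup>2"
      by (simp add: power2_eq_square algebra_simps)
    moreover have "0 \<le> 2 * (1 + Re z)\<^sup>2" by simp
    ultimately show ?thesis by linarith
  qed
  have "- 4 * real m - real k \<ge> - (10 / 3 + 30 * (1 - 1))"
  proof (rule tendsto_le)
    show "((\<lambda>s. - (10 / 3 + 30 * (s - 1))) \<longlongrightarrow> - (10 / 3 + 30 * (1 - 1))) (at_right (1::real))"
      by (intro tendsto_intros)
    show "((\<lambda>s. 4 * ((s - 1) * Re (mangoldt_series chi s)) + (s - 1) * Re (mangoldt_series psi s))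
        \<longlongrightarrow> - 4 * real m - real k) (at_right 1)"
      using tendsto_add[OF tendsto_mult_left[OF m(2), of 4] k] by simp
    show "eventually (\<lambda>s. - (10 / 3 + 30 * (s - 1)) \<le>
        4 * ((s - 1) * Re (mangoldt_series chi s)) + (s - 1) * Re (mangoldt_series psi s)) (at_right 1)"
      using eventually_at_right_less[of 1]
    proof eventually_elim
      case (elim s)
      define a where "a = (\<lambda>n. mangoldt (Suc n) * real (Suc n) powr - s)"
      have sma: "summable a"
        using summable_norm_mangoldt_series[of "\<lambda>_. 1" s] elim
        by (simp add: a_def norm_mult abs_mult del: of_nat_Suc)
      have sm: "summable (\<lambda>n. chi (int (Suc n)) * of_real (a n))"
        "summable (\<lambda>n. psi (int (Suc n)) * of_real (a n))"
        unfolding a_def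
        using summable_norm_cancel[OF summable_norm_mangoldt_series[OF norm(1) elim]]
          summable_norm_cancel[OF summable_norm_mangoldt_series[OF norm(2) elim]] by simp_all
      have "0 \<le> (\<Sum>n. 3 * a n + 4 * Re (chi (int (Suc n)) * of_real (a n)) + Re (psi (int (Suc n)) * of_real (a n)))"
      proof (rule suminf_nonneg)
        show "summable (\<lambda>n. 3 * a n + 4 * Re (chi (int (Suc n)) * of_real (a n)) + Re (psi (int (Suc n)) * of_real (a n)))"
          by (intro summable_add summable_mult sma summable_Re sm)
        fix n
        have "0 \<le> (3 + 4 * Re (chi (int (Suc n))) + Re (psi (int (Suc n)))) * a n"
          unfolding psi_def a_def
          by (intro mult_nonneg_nonneg ineq norm mangoldt_nonneg) auto
        thus "0 \<le> 3 * a n + 4 * Re (chi (int (Suc n)) * of_real (a n)) + Re (psi (int (Suc n)) * of_real (a n))"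
          by (simp add: algebra_simps)
      qed
      also have "\<dots> = 3 * (\<Sum>n. a n) + 4 * Re (mangoldt_series chi s) + Re (mangoldt_series psi s)"
      proof -
        have "Re (mangoldt_series chi s) = (\<Sum>n. Re (chi (int (Suc n)) * of_real (a n)))"
          "Re (mangoldt_series psi s) = (\<Sum>n. Re (psi (int (Suc n)) * of_real (a n)))"
          unfolding mangoldt_series_def using sm by (simp_all only: a_def Re_suminf)
        thus ?thesis
          using sma summable_Re[OF sm(1)] summable_Re[OF sm(2)]
          by (simp only: suminf_add[symmetric] suminf_mult summable_add summable_mult)
      qed
      finally have "0 \<le> (s - 1) * (3 * (\<Sum>n. a n) + 4 * Re (mangoldt_series chi s) + Re (mangoldt_series psi s))"
        using elim by simp
      moreover have "(s - 1) * (\<Sum>n. a n) \<le> 10 / 9 + 10 * (s - 1)"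
        using mangoldt_zeta_bound[of "s - 1"] elim by (simp add: a_def)
      ultimately show ?case by (simp add: algebra_simps)
    qed
  qed simp
  hence "m = 0" by simp
  thus ?thesis using m(1) by simp
qed

section \<open>Growth of log Gamma and scaled Gamma integrals\<close>

lemma ln_Gamma_plus1:
  assumes "Re z > 0"
  shows "ln_Gamma (z + 1) = ln_Gamma z + Ln z"
proof -
  have "\<exists>c. \<forall>z\<in>{z. Re z > 0}. ln_Gamma (z + 1) - ln_Gamma z - Ln z = c"
  proof (rule has_field_derivative_zero_constant)
    show "convex {z. Re z > 0}" by (rule convex_halfspace_Re_gt)
    fix z :: complex assume "z \<in> {z. Re z > 0}"
    hence z: "Re z > 0" by simp
    hence z': "z \<notin> \<real>\<^sub>\<le>\<^sub>0" "z + 1 \<notin> \<real>\<^sub>\<le>\<^sub>0" "z \<noteq> 0" by (auto simp: complex_nonpos_Reals_iff)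
    have "((\<lambda>z. ln_Gamma (z + 1) - ln_Gamma z - Ln z) has_field_derivative
        Digamma (z + 1) * 1 - Digamma z - inverse z) (at z)"
      using z' by (intro derivative_intros DERIV_chain2[of ln_Gamma _ "\<lambda>z. z + 1"])
        (auto intro!: derivative_eq_intros)
    thus "((\<lambda>z. ln_Gamma (z + 1) - ln_Gamma z - Ln z) has_field_derivative 0) (at z within {z. Re z > 0})"
      using Digamma_plus1[of z] z' by (simp add: has_field_derivative_at_within inverse_eq_divide)
  qed
  then obtain c where c: "\<And>z. Re z > 0 \<Longrightarrow> ln_Gamma (z + 1) - ln_Gamma z - Ln z = c" by auto
  have "ln_Gamma (of_nat 1 :: complex) = 0" "ln_Gamma (of_nat 2 :: complex) = 0"
    by (subst ln_Gamma_complex_conv_fact; simp)+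
  hence "c = 0" using c[of 1] by simp
  thus ?thesis using c[OF assms] by (simp add: algebra_simps)
qed

lemma norm_Polygamma_1_le:
  assumes "Re z \<ge> (1 :: real)"
  shows "norm (Polygamma 1 z) \<le> (\<Sum>k. inverse (real (Suc k) ^ 2))"
proof -
  have sm: "summable (\<lambda>k. inverse (real (Suc k) ^ 2))"
    using inverse_power_summable[of 2, where 'a = real] by (subst summable_Suc_iff) simp
  have le: "norm (inverse ((z + of_nat k) ^ 2)) \<le> inverse (real (Suc k) ^ 2)" for k
  proof -
    have "real (Suc k) \<le> Re (z + of_nat k)" using assms by simp
    also have "\<dots> \<le> norm (z + of_nat k)" by (rule complex_Re_le_cmod)
    finally have "real (Suc k) ^ 2 \<le> norm (z + of_nat k) ^ 2" by (intro power_mono) auto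
    thus ?thesis unfolding norm_inverse norm_power by (intro le_imp_inverse_le) auto
  qed
  have "Polygamma 1 z = (\<Sum>k. inverse ((z + of_nat k) ^ 2))"
    by (simp add: Polygamma_def numeral_2_eq_2)
  also have "norm \<dots> \<le> (\<Sum>k. inverse (real (Suc k) ^ 2))"
    by (rule norm_suminf_le[OF le sm])
  finally show ?thesis .
qed

text \<open>
  Far weaker than Stirling's formula, but enough: the derivative of the Digamma function is bounded
  on \<open>Re z \<ge> 1\<close>, and two integrations give a quadratic bound.
\<close>

lemma norm_ln_Gamma_le_quadratic:
  obtains C where "C \<ge> 0" "\<And>z. Re z \<ge> 1 \<Longrightarrow> norm (ln_Gamma z :: complex) \<le> C * (1 + norm z)\<^sup>2"
proof -
  define K where "K = (\<Sum>k. inverse (real (Suc k) ^ 2))"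
  define M where "M = K + norm (Digamma 1 :: complex)"
  have K: "K \<ge> 0" using order_trans[OF norm_ge_zero norm_Polygamma_1_le[of 1]] by (simp add: K_def)
  hence M: "M \<ge> 0" by (simp add: M_def)
  have nonpos: "z \<notin> \<real>\<^sub>\<le>\<^sub>0" "z \<notin> \<int>\<^sub>\<le>\<^sub>0" if "Re z \<ge> 1" for z
    using that by (auto simp: complex_nonpos_Reals_iff elim!: nonpos_Ints_cases)
  have convex: "convex {z. Re z \<ge> 1}" by (rule convex_halfspace_Re_ge)
  have dg: "norm (Digamma z) \<le> M * (1 + norm z)" if z: "Re z \<ge> 1" for z
  proof -
    have "norm (Digamma z - Digamma 1) \<le> K * norm (z - 1)"
    proof (rule field_differentiable_bound[OF convex])
      fix w :: complex assume "w \<in> {z. Re z \<ge> 1}"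
      thus "(Digamma has_field_derivative Polygamma 1 w) (at w within {z. Re z \<ge> 1})"
        using has_field_derivative_Polygamma[of w 0] nonpos(2)[of w] by simp
      show "norm (Polygamma 1 w) \<le> K"
        unfolding K_def using \<open>w \<in> _\<close> by (intro norm_Polygamma_1_le) simp
    qed (use z in auto)
    also have "norm (z - 1) \<le> 1 + norm z" using norm_triangle_ineq4[of z 1] by simp
    finally have "norm (Digamma z - Digamma 1) \<le> K * (1 + norm z)" using K by (simp add: mult_left_mono)
    hence "norm (Digamma z) \<le> K * (1 + norm z) + norm (Digamma 1 :: complex)"
      using norm_triangle_sub[of "Digamma z" "Digamma 1"] by linarith
    also have "\<dots> \<le> K * (1 + norm z) + norm (Digamma 1 :: complex) * (1 + norm z)"
      by (simp add: algebra_simps)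
    finally show ?thesis by (simp add: M_def algebra_simps)
  qed
  show ?thesis
  proof (rule that[of "2 * M"])
    fix z :: complex assume z: "Re z \<ge> 1"
    define S where "S = closed_segment 1 z"
    have sub: "S \<subseteq> {z. Re z \<ge> 1}" "S \<subseteq> cball 0 (1 + norm z)"
      unfolding S_def by (rule closed_segment_subset; use z in \<open>simp add: convex\<close>)+
    have "ln_Gamma (of_nat 1 :: complex) = 0" by (subst ln_Gamma_complex_conv_fact; simp)
    hence "norm (ln_Gamma z) = norm (ln_Gamma z - ln_Gamma 1)" by simp
    also have "\<dots> \<le> (M * (2 + norm z)) * norm (z - 1)"
    proof (rule field_differentiable_bound[where S = S])
      fix w assume w: "w \<in> S"
      have "w \<notin> \<real>\<^sub>\<le>\<^sub>0" using w sub by (intro nonpos(1)) auto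
      thus "(ln_Gamma has_field_derivative Digamma w) (at w within S)"
        by (rule has_field_derivative_at_within[OF has_field_derivative_ln_Gamma_complex])
      have "norm (Digamma w) \<le> M * (1 + norm w)" using w sub by (intro dg) auto
      also have "\<dots> \<le> M * (2 + norm z)" using w sub M by (intro mult_left_mono) auto
      finally show "norm (Digamma w) \<le> M * (2 + norm z)" .
    qed (auto simp: S_def)
    also have "\<dots> \<le> (M * (2 * (1 + norm z))) * (1 + norm z)"
      using M norm_triangle_ineq4[of z 1] by (intro mult_mono) auto
    finally show "norm (ln_Gamma z) \<le> 2 * M * (1 + norm z)\<^sup>2"
      by (simp add: power2_eq_square mult_ac)
  qed (use M in auto)
qed

text \<open>
  A bound for the logarithm that is uniform on the strip \<open>0 \<le> Re z \<le> 1\<close> and has an integrable singularity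
  at \<open>Im z = 0\<close>.
\<close>

lemma norm_Ln_le:
  assumes "Re z \<ge> 0" "Re z \<le> 1" "Im z \<noteq> 0"
  shows "norm (Ln z) \<le> 4 * (\<bar>Im z\<bar> powr (-1/2) + 1 + \<bar>Im z\<bar>)"
proof -
  define y where "y = \<bar>Im z\<bar>"
  have y: "y > 0" using assms by (simp add: y_def)
  have z: "z \<noteq> 0" using assms by auto
  have le: "y \<le> norm z" unfolding y_def by (rule abs_Im_le_cmod)
  have "norm z \<le> 1 + y" using cmod_le[of z] assms by (simp add: y_def)
  hence "ln (norm z) \<le> ln (1 + y)" using z y by (subst ln_le_cancel_iff) auto
  also have "\<dots> \<le> y" using y by (intro ln_add_one_self_le_self) auto
  finally have 1: "ln (norm z) \<le> y" .
  have "ln y \<le> ln (norm z)" using le y z by (subst ln_le_cancel_iff) auto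
  hence "- ln (norm z) \<le> - ln y" by simp
  also have "- ln y = 2 * ln (y powr (-1/2))" by simp
  also have "\<dots> \<le> 2 * (y powr (-1/2))"
    using ln_add_one_self_le_self[of "y powr (-1/2)"] y
    by (smt (verit) ln_le_minus_one powr_gt_zero)
  finally have 2: "- ln (norm z) \<le> 2 * (y powr (-1/2))" .
  have "norm (Ln z) \<le> \<bar>Re (Ln z)\<bar> + \<bar>Im (Ln z)\<bar>" by (rule cmod_le)
  moreover have "\<bar>Im (Ln z)\<bar> \<le> 4"
    using mpi_less_Im_Ln[OF z] Im_Ln_le_pi[OF z] pi_less_4 by linarith
  moreover have "\<bar>Re (Ln z)\<bar> \<le> 2 * (y powr (-1/2)) + y"
  proof (rule abs_leI)
    have "0 \<le> y powr (-1/2)" by simp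
    thus "Re (Ln z) \<le> 2 * (y powr (-1/2)) + y" "- Re (Ln z) \<le> 2 * (y powr (-1/2)) + y"
      using 1 2 y unfolding Re_Ln[OF z] by linarith+
  qed
  ultimately have "norm (Ln z) \<le> 2 * (y powr (-1/2)) + y + 4" by linarith
  moreover have "0 \<le> y powr (-1/2)" by simp
  ultimately show ?thesis using y unfolding y_def[symmetric] distrib_left by linarith
qed

lemma norm_ln_Gamma_le_vertical:
  obtains C where "C \<ge> 0" "\<And>z. Re z > 0 \<Longrightarrow> \<bar>Im z\<bar> \<ge> 1 \<Longrightarrow> norm (ln_Gamma z :: complex) \<le> C * (1 + norm z)\<^sup>2"
proof -
  obtain C where C: "C \<ge> 0" "\<And>z. Re z \<ge> 1 \<Longrightarrow> norm (ln_Gamma z :: complex) \<le> C * (1 + norm z)\<^sup>2"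
    using norm_ln_Gamma_le_quadratic by blast
  show ?thesis
  proof (rule that[of "4 * C + 8"])
    fix z :: complex assume z: "Re z > 0" "\<bar>Im z\<bar> \<ge> 1"
    show "norm (ln_Gamma z :: complex) \<le> (4 * C + 8) * (1 + norm z)\<^sup>2"
    proof (cases "Re z \<ge> 1")
      case True
      have "norm (ln_Gamma z) \<le> C * (1 + norm z)\<^sup>2" by (rule C(2)[OF True])
      also have "\<dots> \<le> (4 * C + 8) * (1 + norm z)\<^sup>2" using C(1) by (intro mult_right_mono) auto
      finally show ?thesis .
    next
      case False
      have "\<bar>Im z\<bar> powr (-1/2) \<le> \<bar>Im z\<bar> powr 0" using z by (intro powr_mono) auto
      moreover have "Im z \<noteq> 0" using z by auto
      ultimately have p: "\<bar>Im z\<bar> powr (-1/2) \<le> 1" by simp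
      have "norm (Ln z) \<le> 4 * (\<bar>Im z\<bar> powr (-1/2) + 1 + \<bar>Im z\<bar>)"
        using z False by (intro norm_Ln_le) auto
      also have "\<dots> \<le> 4 * (2 * (1 + norm z))" using p abs_Im_le_cmod[of z] by simp
      also have "\<dots> \<le> 4 * (2 * (1 + norm z)\<^sup>2)"
        by (intro mult_left_mono self_le_power) auto
      finally have 1: "norm (Ln z) \<le> 8 * (1 + norm z)\<^sup>2" by simp
      have "norm (ln_Gamma (z + 1)) \<le> C * (1 + norm (z + 1))\<^sup>2" using z by (intro C(2)) auto
      also have "\<dots> \<le> C * (2 * (1 + norm z))\<^sup>2"
      proof (intro mult_left_mono power_mono C(1))
        show "1 + norm (z + 1) \<le> 2 * (1 + norm z)"
        proof -
          have "1 + a \<le> 2 * (1 + b)" if "a \<le> b + 1" "0 \<le> b" for a b :: real using that by simp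
          from this[OF norm_triangle_ineq[of z 1, unfolded norm_one] norm_ge_zero] show ?thesis .
        qed
      qed auto
      also have "\<dots> = 4 * C * (1 + norm z)\<^sup>2" unfolding power_mult_distrib by simp
      finally have "norm (ln_Gamma (z + 1)) \<le> 4 * C * (1 + norm z)\<^sup>2" .
      moreover have "ln_Gamma z = ln_Gamma (z + 1) - Ln z" using ln_Gamma_plus1[OF z(1)] by simp
      ultimately have "norm (ln_Gamma z) \<le> 4 * C * (1 + norm z)\<^sup>2 + 8 * (1 + norm z)\<^sup>2"
        using 1 norm_triangle_ineq4[of "ln_Gamma (z + 1)" "Ln z"] by simp
      thus ?thesis by (simp add: algebra_simps)
    qed
  qed (use C in auto)
qed

text \<open>
  The Mellin transform of \<open>exp (- a t)\<close>.
\<close>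

lemma has_integral_Gamma_scaled:
  assumes s: "s > (0 :: real)" and a: "a > 0"
  shows "((\<lambda>t. t powr (s - 1) * exp (- a * t)) has_integral Gamma s / a powr s) {0<..}"
proof -
  have "((\<lambda>t. t powr (s - 1) / exp t) has_integral Gamma s) {0..}" by (rule Gamma_integral_real[OF s])
  moreover have "negligible {x \<in> {0..} - {0<..}. x powr (s - 1) / exp x \<noteq> 0}"
    "negligible {x \<in> {0<..} - {0..}. x powr (s - 1) / exp x \<noteq> 0}"
    by (rule negligible_subset[of "{0}"]; force)+
  ultimately have G: "((\<lambda>t. t powr (s - 1) / exp t) has_integral Gamma s) {0<..}"
    using has_integral_spike_set_eq[of "{0..}" "{0<..}" "\<lambda>t. t powr (s - 1) / exp t" "Gamma s"] by simp
  have "(\<lambda>t. t powr (s - 1) / exp t) absolutely_integrable_on {0<..}"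
    using G by (intro nonnegative_absolutely_integrable_1) auto
  moreover have img: "(*) a ` {0<..} = {0<..}"
  proof (intro equalityI subsetI)
    fix x :: real assume "x \<in> {0<..}"
    thus "x \<in> (*) a ` {0<..}" using a by (intro image_eqI[of _ _ "x / a"]) auto
  qed (use a in auto)
  ultimately have "(\<lambda>x. \<bar>a\<bar> * ((a * x) powr (s - 1) / exp (a * x))) absolutely_integrable_on {0<..} \<and>
      integral {0<..} (\<lambda>x. \<bar>a\<bar> * ((a * x) powr (s - 1) / exp (a * x))) = Gamma s"
    using G a
    by (subst has_absolute_integral_change_of_variables_1'[where g' = "\<lambda>_. a"])
       (auto intro!: derivative_eq_intros inj_onI)
  hence "((\<lambda>x. \<bar>a\<bar> * ((a * x) powr (s - 1) / exp (a * x))) has_integral Gamma s) {0<..}"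
    using set_lebesgue_integral_eq_integral(1) has_integral_integrable_integral by blast
  hence "((\<lambda>x. (\<bar>a\<bar> * ((a * x) powr (s - 1) / exp (a * x))) / a powr s) has_integral Gamma s / a powr s) {0<..}"
    by (rule has_integral_divide)
  thus ?thesis
  proof (rule has_integral_eq[rotated])
    fix x :: real assume x: "x \<in> {0<..}"
    have "a powr s = a powr (s - 1) * a" using a by (simp add: powr_diff)
    thus "(\<bar>a\<bar> * ((a * x) powr (s - 1) / exp (a * x))) / a powr s = x powr (s - 1) * exp (- a * x)"
      using a x by (simp add: powr_mult exp_minus field_simps)
  qed
qed

lemma Gamma_scaled_integrable:
  assumes "r > (-1 :: real)" "a > 0"
  shows "(\<lambda>t. t powr r * exp (- a * t)) integrable_on {0<..}"
  using has_integral_Gamma_scaled[of "r + 1" a] assms by (auto simp: integrable_on_def)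

section \<open>The periodic kernel of an odd character\<close>

text \<open>
  The additive character \<open>exp (2 \<pi> i z)\<close> of period 1.
\<close>

definition e2pi :: "complex \<Rightarrow> complex" where
  "e2pi z = exp (2 * of_real pi * \<i> * z)"

lemma e2pi_0 [simp]: "e2pi 0 = 1"
  by (simp add: e2pi_def)

lemma e2pi_nonzero [simp]: "e2pi z \<noteq> 0"
  by (simp add: e2pi_def)

lemma e2pi_add: "e2pi (x + y) = e2pi x * e2pi y"
  by (simp add: e2pi_def exp_add algebra_simps)

lemma e2pi_uminus: "e2pi (- z) = inverse (e2pi z)"
  by (simp add: e2pi_def exp_minus)

lemma e2pi_power: "e2pi z ^ n = e2pi (of_nat n * z)"
  by (simp add: e2pi_def exp_of_nat_mult[symmetric] algebra_simps)

lemma norm_e2pi: "norm (e2pi z) = exp (- 2 * pi * Im z)"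
  by (simp add: e2pi_def)

lemma e2pi_eq_1_iff: "e2pi z = 1 \<longleftrightarrow> Im z = 0 \<and> (\<exists>n::int. Re z = of_int n)"
  by (auto simp: e2pi_def exp_eq_1)

lemma e2pi_of_nat [simp]: "e2pi (of_nat n) = 1"
  by (auto simp: e2pi_eq_1_iff intro!: exI[of _ "int n"])

lemma e2pi_imaginary: "e2pi (\<i> * of_real y) = of_real (exp (- 2 * pi * y))"
  by (simp add: e2pi_def exp_of_real[symmetric] mult_ac)

lemma holomorphic_e2pi [holomorphic_intros]: "f holomorphic_on S \<Longrightarrow> (\<lambda>z. e2pi (f z)) holomorphic_on S"
  unfolding e2pi_def by (intro holomorphic_intros)

lemma norm_dirichlet_character:
  assumes "dirichlet_character q chi" "coprime n (int q)" "q > 0"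
  shows "norm (chi n) = 1"
proof -
  have "norm (chi n) ^ totient q = 1 ^ totient q"
    using dirichlet_character_root_of_unity[OF assms] by (metis norm_one norm_power power_one)
  moreover have "totient q > 0" using assms(3) by simp
  ultimately show ?thesis by (metis norm_ge_zero power_eq_imp_eq_base zero_le_one)
qed

text \<open>
  An odd Dirichlet character to a prime modulus; such a modulus is never 2 (see \<open>q_odd\<close> below).
\<close>

locale odd_prime_character =
  fixes q :: nat and chi :: "int \<Rightarrow> complex"
  assumes prime_q: "prime q" and odd_chi: "chi \<in> odd_characters q"
begin

lemma q_gt_1: "q > 1"
  using prime_q prime_gt_1_nat by blast

lemma q_pos: "q > 0"
  using q_gt_1 by simp

lemma character: "dirichlet_character q chi"
  using odd_chi by (simp add: odd_characters_def)

lemma nontrivial: "chi \<in> nontrivial_characters q"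
  using odd_chi nontrivial_eq_even_Un_odd(3)[OF q_pos] by blast

lemma norm_le_1: "norm (chi n) \<le> 1"
  by (rule dirichlet_character_norm_le_1[OF character q_pos])

lemma chi_0 [simp]: "chi 0 = 0"
  using dirichlet_character_nz[OF character, of 0] q_gt_1 by auto

lemma chi_cong: "[m = n] (mod int q) \<Longrightarrow> chi m = chi n"
  by (rule dirichlet_character_cong[OF character])

lemma chi_uminus: "chi (- n) = - chi n"
  using dirichlet_character_mult[OF character, of "-1" n] odd_chi by (simp add: odd_characters_def)

lemma coprime_q: "0 < k \<Longrightarrow> k < q \<Longrightarrow> coprime (int k) (int q)"
  using prime_q by (simp add: prime_nat_iff'' coprime_commute)

lemma sum_chi_0: "(\<Sum>n<q. chi (int n)) = 0"
  by (rule sum_nontrivial_character[OF nontrivial q_pos])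

text \<open>
  The sum of \<open>chi a * w ^ a\<close> over the residues; the term \<open>a = 0\<close> vanishes.
\<close>

definition chi_poly :: "complex \<Rightarrow> complex" where
  "chi_poly w = (\<Sum>a<q. chi (int a) * w ^ a)"

text \<open>
  The Gauss sum of \<open>chi\<close>.
\<close>

definition gauss_sum :: complex where
  "gauss_sum = (\<Sum>a<q. chi (int a) * e2pi (of_nat a / of_nat q))"

text \<open>
  The kernel \<open>h\<close> of the contour integral. Numerator and denominator of \<open>chi_poly w / (1 - w ^ q)\<close> are both divided
  by \<open>1 - w\<close>, where \<open>w = e2pi z\<close>: this removes the singularities at the integers, at which the undivided quotient
  would be \<open>0 / 0\<close>.
\<close>

definition chi_kernel :: "complex \<Rightarrow> complex" where
  "chi_kernel z = (\<Sum>n<q. (\<Sum>a\<le>n. chi (int a)) * e2pi z ^ n) / (\<Sum>n<q. e2pi z ^ n)"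

lemma chi_kernel_eq:
  assumes "e2pi z \<noteq> 1"
  shows "chi_kernel z = chi_poly (e2pi z) / (1 - e2pi z ^ q)"
proof -
  define w where "w = e2pi z"
  \<comment> \<open>Summation by parts.\<close>
  have "(1 - w) * (\<Sum>n<N. (\<Sum>a\<le>n. chi (int a)) * w ^ n) =
      (\<Sum>a<N. chi (int a) * w ^ a) - (\<Sum>a<N. chi (int a)) * w ^ N" for N
  proof (induction N)
    case (Suc N)
    have "(\<Sum>a\<le>N. chi (int a)) = (\<Sum>a<N. chi (int a)) + chi (int N)"
      by (simp flip: lessThan_Suc_atMost)
    moreover have "(1 - w) * (X + (s + c) * x) = P + c * x - (s + c) * (w * x)"
      if "(1 - w) * X = P - s * x" for X s c x P
      using that by (simp add: algebra_simps)
    from this[OF Suc.IH]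
    have "(1 - w) * ((\<Sum>n<N. (\<Sum>a\<le>n. chi (int a)) * w ^ n) + ((\<Sum>a<N. chi (int a)) + chi (int N)) * w ^ N) =
      (\<Sum>a<N. chi (int a) * w ^ a) + chi (int N) * w ^ N - ((\<Sum>a<N. chi (int a)) + chi (int N)) * (w * w ^ N)" .
    ultimately show ?case by (simp only: sum.lessThan_Suc power_Suc)
  qed simp
  from this[of q] have "(1 - w) * (\<Sum>n<q. (\<Sum>a\<le>n. chi (int a)) * w ^ n) = chi_poly w"
    by (simp add: sum_chi_0 chi_poly_def)
  moreover have "1 - w ^ q = (1 - w) * (\<Sum>n<q. w ^ n)" by (rule one_diff_power_eq)
  ultimately show ?thesis
    using assms unfolding chi_kernel_def w_def[symmetric] by (metis mult_divide_mult_cancel_left right_minus_eq)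
qed

text \<open>
  The oddness of \<open>chi\<close> in terms of the polynomial; it makes the kernel even.
\<close>

lemma chi_poly_reflect:
  assumes "w \<noteq> 0"
  shows "chi_poly (inverse w) * w ^ q = - chi_poly w"
proof -
  have eq: "chi_poly w = (\<Sum>a=1..<q. chi (int a) * w ^ a)" for w
    unfolding chi_poly_def using q_pos by (simp add: lessThan_atLeast0 sum.atLeast_Suc_lessThan)
  have "chi_poly (inverse w) * w ^ q = (\<Sum>a=1..<q. chi (int a) * w ^ (q - a))"
    unfolding eq sum_distrib_right using assms
    by (intro sum.cong) (auto simp: power_diff power_inverse field_simps)
  also have "\<dots> = (\<Sum>a=1..<q. - (chi (int a) * w ^ a))"
  proof (rule sum.reindex_bij_witness[of _ "\<lambda>a. q - a" "\<lambda>a. q - a"])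
    fix a assume a: "a \<in> {1..<q}"
    have "[int (q - a) = - int a] (mod int q)"
      using a by (simp add: of_nat_diff cong_iff_dvd_diff)
    hence "chi (int (q - a)) = - chi (int a)" using chi_cong chi_uminus by metis
    thus "- (chi (int (q - a)) * w ^ (q - a)) = chi (int a) * w ^ (q - a)" by simp
  qed auto
  also have "\<dots> = - chi_poly w" unfolding eq by (simp add: sum_negf)
  finally show ?thesis .
qed

lemma chi_kernel_uminus: "chi_kernel (- z) = chi_kernel z"
proof (cases "e2pi z = 1")
  case True
  thus ?thesis unfolding chi_kernel_def e2pi_uminus by simp
next
  case False
  define w where "w = e2pi z"
  have w: "w \<noteq> 0" "w \<noteq> 1" "inverse w \<noteq> 1" using False by (auto simp: w_def)
  have "chi_kernel (- z) = chi_poly (inverse w) / (1 - inverse w ^ q)"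
    using w by (subst chi_kernel_eq) (auto simp: w_def e2pi_uminus)
  also have "\<dots> = (chi_poly (inverse w) * w ^ q) / ((1 - inverse w ^ q) * w ^ q)"
    using w by simp
  also have "(1 - inverse w ^ q) * w ^ q = - (1 - w ^ q)"
    using w by (simp add: power_inverse field_simps)
  also have "chi_poly (inverse w) * w ^ q = - chi_poly w" by (rule chi_poly_reflect[OF w(1)])
  also have "- chi_poly w / - (1 - w ^ q) = chi_poly w / (1 - w ^ q)" by (rule minus_divide_divide)
  finally show ?thesis using False by (simp add: chi_kernel_eq w_def)
qed

lemma chi_kernel_plus1: "chi_kernel (z + 1) = chi_kernel z"
  using e2pi_of_nat[of 1] by (simp add: chi_kernel_def e2pi_add)

lemma gauss_sum_twisted:
  assumes "0 < k" "k < q"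
  shows "chi_poly (e2pi (of_nat k / of_nat q)) = cnj (chi (int k)) * gauss_sum"
proof -
  have cop: "coprime k q" using coprime_q[OF assms] by simp
  have bij: "bij_betw (\<lambda>a. (k * a) mod q) {..<q} {..<q}"
  proof -
    have inj: "inj_on (\<lambda>a. (k * a) mod q) {..<q}"
    proof (rule inj_onI)
      fix x y assume xy: "x \<in> {..<q}" "y \<in> {..<q}" "k * x mod q = k * y mod q"
      hence "[k * x = k * y] (mod q)" by (simp add: cong_def)
      hence "[x = y] (mod q)" using cop by (simp add: cong_mult_lcancel_nat)
      thus "x = y" using xy by (simp add: cong_def)
    qed
    moreover have "(\<lambda>a. (k * a) mod q) ` {..<q} = {..<q}"
      by (rule endo_inj_surj) (use inj q_pos in auto)
    ultimately show ?thesis by (simp add: bij_betw_def)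
  qed
  have "chi (int k) * chi_poly (e2pi (of_nat k / of_nat q)) =
      (\<Sum>a<q. chi (int ((k * a) mod q)) * e2pi (of_nat ((k * a) mod q) / of_nat q))"
    unfolding chi_poly_def sum_distrib_left
  proof (rule sum.cong[OF refl])
    fix a
    have "chi (int ((k * a) mod q)) = chi (int k * int a)"
      by (rule chi_cong) (simp add: cong_def zmod_int)
    also have "\<dots> = chi (int k) * chi (int a)" by (rule dirichlet_character_mult[OF character])
    finally have 1: "chi (int ((k * a) mod q)) = chi (int k) * chi (int a)" .
    have "complex_of_nat (k * a) = of_nat ((k * a) mod q + q * ((k * a) div q))" by simp
    also have "\<dots> = of_nat ((k * a) mod q) + of_nat q * of_nat ((k * a) div q)"
      by (simp only: of_nat_add of_nat_mult)
    finally have "of_nat a * (of_nat k / of_nat q) =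
        of_nat ((k * a) mod q) / of_nat q + complex_of_nat ((k * a) div q)"
      using q_pos by (simp add: field_simps)
    hence "e2pi (of_nat k / of_nat q) ^ a = e2pi (of_nat ((k * a) mod q) / of_nat q)"
      by (simp add: e2pi_power e2pi_add)
    with 1 show "chi (int k) * (chi (int a) * e2pi (of_nat k / of_nat q) ^ a) =
        chi (int ((k * a) mod q)) * e2pi (of_nat ((k * a) mod q) / of_nat q)" by simp
  qed
  also have "\<dots> = gauss_sum"
    unfolding gauss_sum_def
    by (rule sum.reindex_bij_betw[OF bij, of "\<lambda>a. chi (int a) * e2pi (of_nat a / of_nat q)"])
  finally have "chi (int k) * chi_poly (e2pi (of_nat k / of_nat q)) = gauss_sum" .
  moreover have "cnj (chi (int k)) * chi (int k) = 1"
    using norm_dirichlet_character[OF character coprime_q[OF assms] q_pos]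
    by (simp add: mult.commute complex_norm_square[symmetric])
  ultimately show ?thesis by (metis mult.assoc mult_1)
qed

text \<open>
  If the Gauss sum vanished, \<open>chi_poly\<close> would vanish at all \<open>q\<close>-th roots of unity, and by orthogonality its
  coefficient \<open>chi 1 = 1\<close> would be 0.
\<close>

lemma gauss_sum_nonzero: "gauss_sum \<noteq> 0"
proof
  assume 0: "gauss_sum = 0"
  have vanish: "chi_poly (e2pi (of_nat k / of_nat q)) = 0" if "k < q" for k
  proof (cases "k = 0")
    case True
    thus ?thesis using sum_chi_0 by (simp add: chi_poly_def)
  qed (use gauss_sum_twisted[of k] that 0 in auto)
  have ortho: "(\<Sum>k<q. e2pi (of_nat k / of_nat q) ^ a * e2pi (- of_nat k / of_nat q)) =
      (if a = 1 then of_nat q else 0)" if "a < q" for a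
  proof -
    define u where "u = e2pi ((of_nat a - 1) / of_nat q)"
    have "(\<Sum>k<q. e2pi (of_nat k / of_nat q) ^ a * e2pi (- of_nat k / of_nat q)) = (\<Sum>k<q. u ^ k)"
      unfolding u_def e2pi_power
      by (intro sum.cong refl) (simp add: e2pi_add[symmetric] diff_divide_distrib algebra_simps)
    also have "\<dots> = (if a = 1 then of_nat q else 0)"
    proof (cases "a = 1")
      case False
      have "u \<noteq> 1"
      proof
        assume "u = 1"
        then obtain n :: int where n: "(real a - 1) / real q = of_int n"
          unfolding u_def e2pi_eq_1_iff by auto
        hence "real_of_int (int a - 1) = real_of_int (n * int q)" using q_pos by (simp add: field_simps)
        hence eq: "int a - 1 = n * int q" by (simp only: of_int_eq_iff)
        hence "int q dvd int a - 1" by simp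
        moreover have "int a - 1 \<noteq> 0" "\<bar>int a - 1\<bar> < int q" using False that q_gt_1 by auto
        ultimately show False using zdvd_imp_le[of "int q" "\<bar>int a - 1\<bar>"] by auto
      qed
      moreover have "u ^ q = 1"
      proof -
        have "u ^ q * e2pi 1 = e2pi (of_nat a)"
          unfolding u_def e2pi_power using q_pos by (simp add: e2pi_add[symmetric])
        thus ?thesis using e2pi_of_nat[of 1] by simp
      qed
      ultimately show ?thesis using False one_diff_power_eq[of u q] by simp
    qed (simp add: u_def)
    finally show ?thesis .
  qed
  have "0 = (\<Sum>k<q. chi_poly (e2pi (of_nat k / of_nat q)) * e2pi (- of_nat k / of_nat q))"
    using vanish by simp
  also have "\<dots> = (\<Sum>a<q. chi (int a) * (\<Sum>k<q. e2pi (of_nat k / of_nat q) ^ a * e2pi (- of_nat k / of_nat q)))"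
    unfolding chi_poly_def sum_distrib_left sum_distrib_right
    by (subst sum.swap) (simp add: mult_ac)
  also have "\<dots> = (\<Sum>a<q. chi (int a) * (if a = 1 then of_nat q else 0))"
    by (rule sum.cong[OF refl], subst ortho) auto
  also have "\<dots> = of_nat q"
    using q_gt_1 dirichlet_character_1[OF character] by (simp add: if_distrib[of "(*) _"] sum.delta cong: if_cong)
  finally show False using q_pos by simp
qed

lemma chi_kernel_denom_nonzero:
  assumes "Re z < 1 + 1 / real q" "Re z > - 1 / real q" and "\<And>k. k \<in> {1..<q} \<Longrightarrow> z \<noteq> of_nat k / of_nat q"
  shows "(\<Sum>n<q. e2pi z ^ n) \<noteq> 0"
proof
  assume 0: "(\<Sum>n<q. e2pi z ^ n) = 0"
  have ne: "e2pi z \<noteq> 1" using 0 q_pos by auto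
  have "e2pi z ^ q = 1" using one_diff_power_eq[of "e2pi z" q] 0 by simp
  hence "e2pi (of_nat q * z) = 1" by (simp add: e2pi_power)
  then obtain n :: int where n: "Im z = 0" "real q * Re z = of_int n"
    using q_pos unfolding e2pi_eq_1_iff by auto
  have z: "z = of_int n / of_nat q" using n q_pos
    by (simp add: complex_eq_iff field_simps)
  have "real_of_int n < real q + 1" "real_of_int n > - 1"
    using assms(1,2) q_pos unfolding n(2)[symmetric] by (auto simp: field_simps)
  hence "n \<le> int q" "n \<ge> 0" by linarith+
  moreover have "n \<noteq> 0" "n \<noteq> int q" using ne z q_pos e2pi_of_nat[of 1] by auto
  ultimately have "nat n \<in> {1..<q}" "z = of_nat (nat n) / of_nat q" using z by auto
  thus False using assms(3) by blast
qed

lemma chi_kernel_holomorphic: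
  assumes "S \<subseteq> {z. - 1 / real q < Re z \<and> Re z < 1 + 1 / real q} - (\<lambda>k. of_nat k / of_nat q) ` {1..<q}"
  shows "chi_kernel holomorphic_on S"
  unfolding chi_kernel_def
  by (intro holomorphic_intros chi_kernel_denom_nonzero) (use assms in auto)

text \<open>
  The residue of the kernel at \<open>k / q\<close>, as a limit.
\<close>

lemma chi_kernel_residue_limit:
  assumes "0 < k" "k < q"
  defines "z0 \<equiv> of_nat k / of_nat q"
  shows "((\<lambda>z. chi_kernel z * (z - z0)) \<longlongrightarrow> - cnj (chi (int k)) * gauss_sum / (2 * of_real pi * \<i> * of_nat q)) (at z0)"
proof -
  have ne: "e2pi z0 \<noteq> 1"
  proof
    assume "e2pi z0 = 1"
    then obtain n :: int where "real k / real q = of_int n" unfolding e2pi_eq_1_iff z0_def by auto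
    moreover have "0 < real k / real q" "real k / real q < 1" using assms by auto
    ultimately show False by auto
  qed
  have cont: "isCont e2pi z" for z unfolding e2pi_def by (intro continuous_intros)
  have pow: "e2pi z0 ^ q = 1" using q_pos by (simp add: e2pi_power z0_def)
  have "((\<lambda>z. 1 - e2pi z ^ q) has_field_derivative - (2 * of_real pi * \<i> * of_nat q)) (at z0)"
  proof -
    have "((\<lambda>z. 1 - exp (2 * of_real pi * \<i> * (of_nat q * z))) has_field_derivative
        - (exp (2 * of_real pi * \<i> * (of_nat q * z0)) * (2 * of_real pi * \<i> * of_nat q))) (at z0)"
      by (auto intro!: derivative_eq_intros)
    moreover have "exp (2 * of_real pi * \<i> * (of_nat q * z0)) = 1"
      using pow unfolding e2pi_power unfolding e2pi_def .
    ultimately show ?thesis by (simp add: e2pi_power) (simp add: e2pi_def)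
  qed
  hence "((\<lambda>z. (1 - e2pi z ^ q) / (z - z0)) \<longlongrightarrow> - (2 * of_real pi * \<i> * of_nat q)) (at z0)"
    using pow by (simp add: has_field_derivative_iff)
  moreover have "((\<lambda>z. chi_poly (e2pi z)) \<longlongrightarrow> chi_poly (e2pi z0)) (at z0)"
    unfolding chi_poly_def by (intro tendsto_intros) (use cont[of z0] in \<open>simp add: isCont_def\<close>)
  ultimately have "((\<lambda>z. chi_poly (e2pi z) / ((1 - e2pi z ^ q) / (z - z0))) \<longlongrightarrow>
      chi_poly (e2pi z0) / - (2 * of_real pi * \<i> * of_nat q)) (at z0)"
    using q_pos by (intro tendsto_divide) auto
  moreover have "eventually (\<lambda>z. e2pi z \<noteq> 1) (at z0)"
    using cont[of z0] ne by (intro tendsto_imp_eventually_ne[where c = "e2pi z0"]) (auto simp: isCont_def)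
  hence "eventually (\<lambda>z. chi_poly (e2pi z) / ((1 - e2pi z ^ q) / (z - z0)) = chi_kernel z * (z - z0)) (at z0)"
    by eventually_elim (simp add: chi_kernel_eq)
  ultimately have "((\<lambda>z. chi_kernel z * (z - z0)) \<longlongrightarrow>
      chi_poly (e2pi z0) / - (2 * of_real pi * \<i> * of_nat q)) (at z0)"
    by (rule Lim_transform_eventually)
  thus ?thesis using gauss_sum_twisted[OF assms(1,2)] by (simp add: z0_def)
qed

lemma chi_kernel_bound_far:
  assumes "\<bar>Im z\<bar> \<ge> 1"
  shows "norm (chi_kernel z) \<le> 2 * real q * exp (- 2 * pi * \<bar>Im z\<bar>)"
proof -
  have upper: "norm (chi_kernel z) \<le> 2 * real q * exp (- 2 * pi * Im z)" if z: "Im z \<ge> 1" for z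
  proof -
    define w where "w = e2pi z"
    have w: "norm w = exp (- 2 * pi * Im z)" by (simp add: w_def norm_e2pi)
    have "1 * 1 \<le> 2 * pi * Im z" using z pi_gt3 by (intro mult_mono) auto
    hence "norm w \<le> exp (- 1)" unfolding w by simp
    also have "\<dots> \<le> 1 / 2" using exp_ge_add_one_self[of 1] by (simp add: exp_minus field_simps)
    finally have half: "norm w \<le> 1 / 2" .
    hence w1: "w \<noteq> 1" by auto
    have "norm (chi_poly w) \<le> (\<Sum>a<q. norm w)"
      unfolding chi_poly_def
    proof (rule sum_norm_le)
      fix a
      show "norm (chi (int a) * w ^ a) \<le> norm w"
      proof (cases a)
        case (Suc b)
        have "norm w ^ b \<le> 1" using half by (intro power_le_one) auto
        hence "norm (chi (int a)) * (norm w * norm w ^ b) \<le> 1 * (norm w * 1)"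
          using norm_le_1[of "int a"] by (intro mult_mono) auto
        thus ?thesis unfolding Suc by (simp add: norm_mult norm_power)
      qed simp
    qed
    hence 1: "norm (chi_poly w) \<le> real q * norm w" by simp
    have "norm w ^ q \<le> norm w ^ 1" using half q_pos by (intro power_decreasing) auto
    hence "norm (w ^ q) \<le> 1 / 2" using half by (simp add: norm_power)
    hence 2: "norm (1 - w ^ q) \<ge> 1 / 2" using norm_triangle_ineq2[of 1 "w ^ q"] by simp
    have "norm (chi_kernel z) = norm (chi_poly w) / norm (1 - w ^ q)"
      using w1 by (simp add: chi_kernel_eq w_def norm_divide)
    also have "\<dots> \<le> (real q * norm w) / (1 / 2)" using 1 2 by (intro frac_le) auto
    finally show ?thesis by (simp add: w)
  qed
  show ?thesis
  proof (cases "Im z \<ge> 0")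
    case True
    thus ?thesis using upper[of z] assms by simp
  next
    case False
    thus ?thesis using upper[of "-z"] assms by (simp add: chi_kernel_uminus)
  qed
qed

text \<open>
  Exponential decay on a vertical strip around the imaginary axis that contains no pole, including the region near \<open>0\<close>.
\<close>

lemma chi_kernel_bound_near:
  obtains C where "C \<ge> 0"
    "\<And>z. \<bar>Re z\<bar> \<le> 1 / (2 * real q) \<Longrightarrow> norm (chi_kernel z) \<le> C * exp (- 2 * pi * \<bar>Im z\<bar>)"
proof -
  define K where "K = cbox (Complex (- 1 / (2 * real q)) (- 1)) (Complex (1 / (2 * real q)) 1)"
  have q: "1 / (2 * real q) < 1 / real q" using q_pos by (simp add: field_simps)
  have "chi_kernel holomorphic_on K"
  proof (rule chi_kernel_holomorphic, rule subsetI)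
    fix z assume "z \<in> K"
    hence z: "- 1 / (2 * real q) \<le> Re z" "Re z \<le> 1 / (2 * real q)" by (auto simp: K_def in_cbox_complex_iff)
    have "z \<noteq> of_nat k / of_nat q" if "k \<in> {1..<q}" for k
    proof
      assume "z = of_nat k / of_nat q"
      hence "Re z = real k / real q" by simp
      moreover have "1 / real q \<le> real k / real q" using that q_pos by (intro divide_right_mono) auto
      ultimately show False using z q by linarith
    qed
    hence "z \<notin> (\<lambda>k. of_nat k / of_nat q) ` {1..<q}" by blast
    moreover have "- 1 / real q < - 1 / (2 * real q)" "1 / (2 * real q) < 1 + 1 / real q"
      using q by auto
    ultimately show "z \<in> {z. - 1 / real q < Re z \<and> Re z < 1 + 1 / real q} - (\<lambda>k. of_nat k / of_nat q) ` {1..<q}"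
      using z by auto
  qed
  hence "compact (chi_kernel ` K)"
    unfolding K_def by (intro compact_continuous_image holomorphic_on_imp_continuous_on compact_cbox)
  then obtain B where B: "\<And>z. z \<in> K \<Longrightarrow> norm (chi_kernel z) \<le> B"
    by (meson bounded_iff compact_imp_bounded imageI)
  define C where "C = max (2 * real q) (\<bar>B\<bar> * exp (2 * pi))"
  show ?thesis
  proof (rule that[of C])
    fix z assume z: "\<bar>Re z\<bar> \<le> 1 / (2 * real q)"
    show "norm (chi_kernel z) \<le> C * exp (- 2 * pi * \<bar>Im z\<bar>)"
    proof (cases "\<bar>Im z\<bar> \<ge> 1")
      case True
      have "norm (chi_kernel z) \<le> 2 * real q * exp (- 2 * pi * \<bar>Im z\<bar>)"
        by (rule chi_kernel_bound_far[OF True])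
      also have "\<dots> \<le> C * exp (- 2 * pi * \<bar>Im z\<bar>)" by (intro mult_right_mono) (auto simp: C_def)
      finally show ?thesis .
    next
      case False
      hence "z \<in> K" using z by (auto simp: K_def in_cbox_complex_iff abs_le_iff)
      hence "norm (chi_kernel z) \<le> \<bar>B\<bar> * (exp (2 * pi) * exp (- 2 * pi))"
        using B[of z] by (simp add: exp_minus)
      also have "\<dots> = (\<bar>B\<bar> * exp (2 * pi)) * exp (- 2 * pi)" by simp
      also have "\<dots> \<le> C * exp (- 2 * pi * \<bar>Im z\<bar>)"
        using False by (intro mult_mono) (auto simp: C_def)
      finally show ?thesis .
    qed
  qed (simp add: C_def)
qed

end

section \<open>The contour integral\<close>

text \<open>
  The majorant of the integrands on the lines \<open>Re z = \<epsilon>\<close>, up to a constant factor.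
\<close>

lemma integrable_dominating_function:
  "(\<lambda>y::real. (y powr (-1/2) + 1 + y) * exp (- 2 * pi * y)) integrable_on {0<..}"
proof -
  have "(\<lambda>y::real. y powr (-1/2) * exp (- (2 * pi) * y) + y powr 0 * exp (- (2 * pi) * y)
      + y powr 1 * exp (- (2 * pi) * y)) integrable_on {0<..}"
    by (intro integrable_add Gamma_scaled_integrable) auto
  thus ?thesis
    by (rule integrable_eq) (auto simp: algebra_simps)
qed

context odd_prime_character
begin

lemma contour_integral_chi_kernel_rectpath:
  assumes H: "H holomorphic_on {z. Re z > 0}" and eps: "0 < \<epsilon>" "\<epsilon> < 1 / real q" and R: "R > 0"
  defines "p \<equiv> rectpath (Complex \<epsilon> (- R)) (Complex (1 + \<epsilon>) R)"
  shows "contour_integral p (\<lambda>z. chi_kernel z * H z) =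
      - gauss_sum / of_nat q * (\<Sum>k=1..<q. cnj (chi (int k)) * H (of_nat k / of_nat q))"
    and "(\<lambda>z. chi_kernel z * H z) holomorphic_on
      {z. 0 < Re z \<and> Re z < 1 + 1 / real q} - (\<lambda>k. of_nat k / of_nat q) ` {1..<q}"
    and "path_image p \<subseteq> {z. 0 < Re z \<and> Re z < 1 + 1 / real q} - (\<lambda>k. of_nat k / of_nat q) ` {1..<q}"
proof -
  define S where "S = {z. 0 < Re z \<and> Re z < 1 + 1 / real q}"
  define pt where "pt = (\<lambda>k::nat. of_nat k / of_nat q :: complex)"
  have S_eq: "S = {z. Re z > 0} \<inter> {z. Re z < 1 + 1 / real q}" by (auto simp: S_def)
  have S: "open S" "convex S"
    unfolding S_eq
    by (rule open_Int[OF open_halfspace_Re_gt open_halfspace_Re_lt]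
        convex_Int[OF convex_halfspace_Re_gt convex_halfspace_Re_lt])+
  have Re_pt: "0 < Re (pt k)" "Re (pt k) < 1" "\<epsilon> < Re (pt k)" "Im (pt k) = 0" if "k \<in> {1..<q}" for k
  proof -
    have "1 / real q \<le> real k / real q" using that q_pos by (intro divide_right_mono) auto
    thus "0 < Re (pt k)" "Re (pt k) < 1" "\<epsilon> < Re (pt k)" "Im (pt k) = 0"
      using eps that by (auto simp: pt_def)
  qed
  have pt_S: "pt ` {1..<q} \<subseteq> S"
  proof
    fix z assume "z \<in> pt ` {1..<q}"
    then obtain k where k: "k \<in> {1..<q}" "z = pt k" by blast
    have "0 < 1 / real q" using q_pos by simp
    with Re_pt(1,2)[OF k(1)] show "z \<in> S" unfolding S_def k(2) mem_Collect_eq by linarith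
  qed
  have "chi_kernel holomorphic_on S - pt ` {1..<q}"
  proof (rule chi_kernel_holomorphic, rule subsetI)
    fix z assume "z \<in> S - pt ` {1..<q}"
    hence z: "0 < Re z" "Re z < 1 + 1 / real q" "z \<notin> pt ` {1..<q}" by (auto simp: S_def)
    have "- 1 / real q < 0" using q_pos by simp
    hence "- 1 / real q < Re z" using z(1) by (rule less_trans)
    thus "z \<in> {z. - 1 / real q < Re z \<and> Re z < 1 + 1 / real q} - (\<lambda>k. of_nat k / of_nat q) ` {1..<q}"
      using z unfolding pt_def by blast
  qed
  moreover have "H holomorphic_on S - pt ` {1..<q}"
    by (rule holomorphic_on_subset[OF H]) (auto simp: S_def)
  ultimately have hol: "(\<lambda>z. chi_kernel z * H z) holomorphic_on S - pt ` {1..<q}"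
    by (rule holomorphic_on_mult)
  thus "(\<lambda>z. chi_kernel z * H z) holomorphic_on
      {z. 0 < Re z \<and> Re z < 1 + 1 / real q} - (\<lambda>k. of_nat k / of_nat q) ` {1..<q}"
    by (simp add: S_def pt_def)
  have cbox: "path_image p \<subseteq> cbox (Complex \<epsilon> (- R)) (Complex (1 + \<epsilon>) R)"
    unfolding p_def using R by (intro path_image_rectpath_subset_cbox) auto
  have cbox_S: "cbox (Complex \<epsilon> (- R)) (Complex (1 + \<epsilon>) R) \<subseteq> S"
    using eps by (auto simp: S_def in_cbox_complex_iff)
  have box: "pt k \<in> box (Complex \<epsilon> (- R)) (Complex (1 + \<epsilon>) R)" if "k \<in> {1..<q}" for k
    using Re_pt[OF that] eps R by (auto simp: in_box_complex_iff)
  have im: "path_image p \<subseteq> S - pt ` {1..<q}"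
  proof -
    have "path_image p \<inter> box (Complex \<epsilon> (- R)) (Complex (1 + \<epsilon>) R) = {}"
      unfolding p_def using R by (intro path_image_rectpath_inter_box) auto
    thus ?thesis using box cbox cbox_S by blast
  qed
  thus "path_image p \<subseteq> {z. 0 < Re z \<and> Re z < 1 + 1 / real q} - (\<lambda>k. of_nat k / of_nat q) ` {1..<q}"
    by (simp add: S_def pt_def)
  have res: "residue (\<lambda>z. chi_kernel z * H z) (pt k) =
      - cnj (chi (int k)) * gauss_sum / (2 * of_real pi * \<i> * of_nat q) * H (pt k)" if k: "k \<in> {1..<q}" for k
  proof (rule residue_simple')
    show "open (S - (pt ` {1..<q} - {pt k}))"
      by (intro open_Diff S finite_imp_closed) auto
    show "pt k \<in> S - (pt ` {1..<q} - {pt k})" using pt_S k by auto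
    show "(\<lambda>z. chi_kernel z * H z) holomorphic_on S - (pt ` {1..<q} - {pt k}) - {pt k}"
      by (rule holomorphic_on_subset[OF hol]) auto
    have "isCont H (pt k)"
      using Re_pt(1)[OF k] H
      by (intro continuous_on_interior[OF holomorphic_on_imp_continuous_on[OF H]])
         (simp add: interior_open open_halfspace_Re_gt)
    hence "(H \<longlongrightarrow> H (pt k)) (at (pt k))" by (simp add: isCont_def)
    with chi_kernel_residue_limit[of k] k
    have "((\<lambda>z. chi_kernel z * (z - pt k) * H z) \<longlongrightarrow>
      - cnj (chi (int k)) * gauss_sum / (2 * of_real pi * \<i> * of_nat q) * H (pt k)) (at (pt k))"
      unfolding pt_def by (intro tendsto_mult) auto
    thus "((\<lambda>z. chi_kernel z * H z * (z - pt k)) \<longlongrightarrow>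
      - cnj (chi (int k)) * gauss_sum / (2 * of_real pi * \<i> * of_nat q) * H (pt k)) (at (pt k))"
      by (simp add: mult_ac)
  qed
  have inj: "inj_on pt {1..<q}" using q_pos by (auto simp: inj_on_def pt_def)
  have "contour_integral p (\<lambda>z. chi_kernel z * H z) =
      2 * pi * \<i> * (\<Sum>z\<in>pt ` {1..<q}. winding_number p z * residue (\<lambda>z. chi_kernel z * H z) z)"
  proof (rule Residue_theorem[OF S(1) convex_connected[OF S(2)] _ hol _ _ im])
    show "valid_path p" "pathfinish p = pathstart p" by (simp_all add: p_def)
    show "\<forall>z. z \<notin> S \<longrightarrow> winding_number p z = 0"
    proof (intro allI impI)
      fix z assume "z \<notin> S"
      thus "winding_number p z = 0"
        using im by (intro winding_number_zero_outside[OF _ S(2)]) (auto simp: p_def)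
    qed
  qed simp
  also have "\<dots> = 2 * pi * \<i> * (\<Sum>k=1..<q. winding_number p (pt k) * residue (\<lambda>z. chi_kernel z * H z) (pt k))"
    by (subst sum.reindex[OF inj]) (simp add: o_def)
  also have "\<dots> = (\<Sum>k=1..<q. - gauss_sum / of_nat q * (cnj (chi (int k)) * H (pt k)))"
    unfolding sum_distrib_left
  proof (rule sum.cong[OF refl])
    fix k assume k: "k \<in> {1..<q}"
    have "winding_number p (pt k) = 1" unfolding p_def by (rule winding_number_rectpath[OF box[OF k]])
    thus "2 * pi * \<i> * (winding_number p (pt k) * residue (\<lambda>z. chi_kernel z * H z) (pt k)) =
        - gauss_sum / of_nat q * (cnj (chi (int k)) * H (pt k))"
      unfolding res[OF k] using q_pos by (simp add: field_simps)
  qed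
  finally show "contour_integral p (\<lambda>z. chi_kernel z * H z) =
      - gauss_sum / of_nat q * (\<Sum>k=1..<q. cnj (chi (int k)) * H (of_nat k / of_nat q))"
    by (simp add: sum_distrib_left pt_def)
qed

text \<open>
  By periodicity of the kernel, the two vertical sides of the rectangle combine to the integral of the kernel
  times \<open>D\<close>, here folded onto \<open>y \<ge> 0\<close>. The error term bounds the two horizontal sides.
\<close>

lemma chi_kernel_vertical_integral_approx:
  assumes H: "H holomorphic_on {z. Re z > 0}"
    and diff: "\<And>z. Re z > 0 \<Longrightarrow> H (z + 1) - H z = D z"
    and bound: "Cb \<ge> 0" "\<And>z. Re z > 0 \<Longrightarrow> \<bar>Im z\<bar> \<ge> 1 \<Longrightarrow> norm (H z) \<le> Cb * (1 + norm z)\<^sup>2"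
    and eps: "0 < \<epsilon>" "\<epsilon> < 1 / real q" and R: "R \<ge> 1"
  defines "\<phi> \<equiv> \<lambda>y. chi_kernel (Complex \<epsilon> y) * D (Complex \<epsilon> y)"
  defines "K \<equiv> - gauss_sum / of_nat q * (\<Sum>k=1..<q. cnj (chi (int k)) * H (of_nat k / of_nat q))"
  shows "(\<lambda>y. \<phi> y + \<phi> (- y)) integrable_on {0..R}"
    and "norm (\<i> * integral {0..R} (\<lambda>y. \<phi> y + \<phi> (- y)) - K)
      \<le> 4 * real q * exp (- 2 * pi * R) * (Cb * (3 + R)\<^sup>2)"
proof -
  define f where "f = (\<lambda>z. chi_kernel z * H z)"
  define T where "T = {z. 0 < Re z \<and> Re z < 1 + 1 / real q} - (\<lambda>k. of_nat k / of_nat q :: complex) ` {1..<q}"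
  define a1 a2 a3 a4 where a: "a1 = Complex \<epsilon> (- R)" "a2 = Complex (1 + \<epsilon>) (- R)"
    "a3 = Complex (1 + \<epsilon>) R" "a4 = Complex \<epsilon> R"
  note rect = contour_integral_chi_kernel_rectpath[OF H eps, of R]
  have R0: "R > 0" using R by simp
  have p: "rectpath (Complex \<epsilon> (- R)) (Complex (1 + \<epsilon>) R) =
      linepath a1 a2 +++ linepath a2 a3 +++ linepath a3 a4 +++ linepath a4 a1"
    by (simp add: rectpath_def Let_def a)
  have CI: "contour_integral (rectpath (Complex \<epsilon> (- R)) (Complex (1 + \<epsilon>) R)) f = K"
    unfolding f_def K_def by (rule rect(1)[OF R0])
  have cont: "continuous_on T f"
    unfolding f_def T_def by (rule holomorphic_on_imp_continuous_on[OF rect(2)[OF R0]])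
  have sub: "closed_segment a1 a2 \<subseteq> T" "closed_segment a2 a3 \<subseteq> T"
    "closed_segment a3 a4 \<subseteq> T" "closed_segment a4 a1 \<subseteq> T"
    using rect(3)[OF R0] unfolding p T_def by (auto simp: path_image_join)
  note int = contour_integrable_continuous_linepath[OF continuous_on_subset[OF cont]]
  have ints: "f contour_integrable_on linepath a1 a2" "f contour_integrable_on linepath a2 a3"
    "f contour_integrable_on linepath a3 a4" "f contour_integrable_on linepath a4 a1"
    by (rule int[OF sub(1)] int[OF sub(2)] int[OF sub(3)] int[OF sub(4)])+
  have split: "K = contour_integral (linepath a1 a2) f + contour_integral (linepath a2 a3) f
      + contour_integral (linepath a3 a4) f + contour_integral (linepath a4 a1) f"
    using CI unfolding p using ints by (simp add: contour_integral_join valid_path_join add.assoc)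
  have seg: "continuous_on {- R..R} (\<lambda>y. f (Complex c y))"
    if "closed_segment (Complex c (- R)) (Complex c R) \<subseteq> T" for c
  proof (rule continuous_on_compose2[OF cont])
    show "continuous_on {- R..R} (Complex c)"
      unfolding Complex_eq by (intro continuous_intros)
    show "Complex c ` {- R..R} \<subseteq> T"
      using that R0 by (force simp: closed_segment_same_Re closed_segment_eq_real_ivl)
  qed
  have i1: "(\<lambda>y. f (Complex (1 + \<epsilon>) y)) integrable_on {- R..R}"
    using seg[of "1 + \<epsilon>"] sub(2) by (intro integrable_continuous_interval) (simp add: a)
  have i2: "(\<lambda>y. f (Complex \<epsilon> y)) integrable_on {- R..R}"
    using seg[of \<epsilon>] sub(4) by (intro integrable_continuous_interval) (simp add: a closed_segment_commute)
  have \<phi>: "\<phi> y = f (Complex (1 + \<epsilon>) y) - f (Complex \<epsilon> y)" for y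
  proof -
    have "Complex (1 + \<epsilon>) y = Complex \<epsilon> y + 1" by (simp add: complex_eq_iff)
    thus ?thesis using diff[of "Complex \<epsilon> y"] eps
      by (simp add: \<phi>_def f_def chi_kernel_plus1 right_diff_distrib[symmetric])
  qed
  have "contour_integral (linepath a2 a3) f = \<i> * integral {- R..R} (\<lambda>y. f (Complex (1 + \<epsilon>) y))"
    using R0 by (intro contour_integral_linepath_same_Re) (auto simp: a)
  moreover have "contour_integral (linepath a4 a1) f = - contour_integral (linepath a1 a4) f"
    by (intro contour_integral_reverse_linepath continuous_on_subset[OF cont])
       (use sub(4) in \<open>simp add: closed_segment_commute\<close>)
  moreover have "contour_integral (linepath a1 a4) f = \<i> * integral {- R..R} (\<lambda>y. f (Complex \<epsilon> y))"
    using R0 by (intro contour_integral_linepath_same_Re) (auto simp: a)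
  ultimately have vert: "contour_integral (linepath a2 a3) f + contour_integral (linepath a4 a1) f =
      \<i> * integral {- R..R} \<phi>"
    unfolding \<phi> using i1 i2 by (simp add: integral_diff right_diff_distrib)
  have \<phi>_int: "\<phi> integrable_on {- R..R}" unfolding \<phi> by (intro integrable_diff i1 i2)
  have pos: "\<phi> integrable_on {0..R}" and neg: "\<phi> integrable_on {- R..0}"
    using R0 by (auto intro: integrable_on_subinterval[OF \<phi>_int])
  have "(\<phi> has_integral integral {- R..0} \<phi>) {- R..0}" using neg by (rule integrable_integral)
  hence "((\<lambda>y. \<phi> (- y)) has_integral integral {- R..0} \<phi>) {- 0..- (- R)}"
    by (subst has_integral_reflect_real)
  hence "((\<lambda>y. \<phi> (- y)) has_integral integral {- R..0} \<phi>) {0..R}"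
    by (simp only: minus_zero minus_minus)
  hence neg': "(\<lambda>y. \<phi> (- y)) integrable_on {0..R}" "integral {0..R} (\<lambda>y. \<phi> (- y)) = integral {- R..0} \<phi>"
    by (auto simp: integrable_on_def integral_unique)
  show "(\<lambda>y. \<phi> y + \<phi> (- y)) integrable_on {0..R}" by (intro integrable_add pos neg')
  have fold: "integral {0..R} (\<lambda>y. \<phi> y + \<phi> (- y)) = integral {- R..R} \<phi>"
    using Henstock_Kurzweil_Integration.integral_combine[OF _ _ \<phi>_int, of 0] R0 pos neg' by (simp add: integral_add add.commute)
  define B where "B = 2 * real q * exp (- 2 * pi * R) * (Cb * (3 + R)\<^sup>2)"
  have B: "norm (f (Complex x y)) \<le> B" if xy: "\<bar>y\<bar> = R" "0 < x" "x \<le> 2" for x y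
  proof -
    have "norm (Complex x y) \<le> 2 + R" using cmod_le[of "Complex x y"] xy by simp
    hence "(1 + norm (Complex x y))\<^sup>2 \<le> (3 + R)\<^sup>2" by (intro power_mono) auto
    hence "Cb * (1 + norm (Complex x y))\<^sup>2 \<le> Cb * (3 + R)\<^sup>2" using bound(1) by (rule mult_left_mono)
    moreover have "norm (H (Complex x y)) \<le> Cb * (1 + norm (Complex x y))\<^sup>2"
      using xy R by (intro bound(2)) auto
    ultimately have "norm (H (Complex x y)) \<le> Cb * (3 + R)\<^sup>2" by linarith
    thus ?thesis
      unfolding f_def B_def norm_mult using chi_kernel_bound_far[of "Complex x y"] xy R
      by (intro mult_mono) auto
  qed
  have B0: "B \<ge> 0" using bound(1) by (simp add: B_def)
  have eps1: "\<epsilon> \<le> 1" using eps q_gt_1 by (intro order_trans[OF less_imp_le[OF eps(2)]]) auto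
  have "norm (contour_integral (linepath a1 a2) f) \<le> B * norm (a2 - a1)"
  proof (rule contour_integral_bound_linepath[OF ints(1) B0])
    fix z assume "z \<in> closed_segment a1 a2"
    hence "Im z = - R" "\<epsilon> \<le> Re z" "Re z \<le> 1 + \<epsilon>"
      by (auto simp: a closed_segment_same_Im closed_segment_eq_real_ivl)
    hence "norm (f (Complex (Re z) (Im z))) \<le> B" using eps eps1 R0 by (intro B) auto
    thus "norm (f z) \<le> B" by simp
  qed
  moreover have "norm (contour_integral (linepath a3 a4) f) \<le> B * norm (a4 - a3)"
  proof (rule contour_integral_bound_linepath[OF ints(3) B0])
    fix z assume "z \<in> closed_segment a3 a4"
    hence "Im z = R" "\<epsilon> \<le> Re z" "Re z \<le> 1 + \<epsilon>"
      by (auto simp: a closed_segment_same_Im closed_segment_eq_real_ivl)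
    hence "norm (f (Complex (Re z) (Im z))) \<le> B" using eps eps1 R0 by (intro B) auto
    thus "norm (f z) \<le> B" by simp
  qed
  moreover have "a2 - a1 = 1" "a4 - a3 = - 1" by (simp_all add: a complex_eq_iff)
  moreover have "\<i> * integral {- R..R} \<phi> - K =
      - (contour_integral (linepath a1 a2) f + contour_integral (linepath a3 a4) f)"
    unfolding split vert[symmetric] by simp
  ultimately have "norm (\<i> * integral {- R..R} \<phi> - K) \<le> B + B"
    using norm_triangle_ineq[of "contour_integral (linepath a1 a2) f" "contour_integral (linepath a3 a4) f"]
    by (simp only: norm_minus_cancel norm_one mult_1_right)
  thus "norm (\<i> * integral {0..R} (\<lambda>y. \<phi> y + \<phi> (- y)) - K)
      \<le> 4 * real q * exp (- 2 * pi * R) * (Cb * (3 + R)\<^sup>2)"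
    unfolding fold by (simp add: B_def algebra_simps)
qed

text \<open>
  The line of integration is moved to the imaginary axis, where \<open>D\<close> may have a singularity at 0, as the
  logarithm does. The strip of width \<open>\<epsilon>\<close> is closed and the height of the rectangle sent to infinity at the same
  time, by dominated convergence. The bound on \<open>D\<close> is the one of \<open>norm_Ln_le\<close>.
\<close>

lemma chi_kernel_contour_formula:
  assumes H: "H holomorphic_on {z. Re z > 0}"
    and diff: "\<And>z. Re z > 0 \<Longrightarrow> H (z + 1) - H z = D z"
    and bound: "Cb \<ge> 0" "\<And>z. Re z > 0 \<Longrightarrow> \<bar>Im z\<bar> \<ge> 1 \<Longrightarrow> norm (H z) \<le> Cb * (1 + norm z)\<^sup>2"
    and contD: "continuous_on ({z. Re z \<ge> 0} - {z. Im z = 0}) D"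
    and boundD: "\<And>z. 0 \<le> Re z \<Longrightarrow> Re z \<le> 1 \<Longrightarrow> Im z \<noteq> 0 \<Longrightarrow>
      norm (D z) \<le> 4 * (\<bar>Im z\<bar> powr (-1/2) + 1 + \<bar>Im z\<bar>)"
  shows "\<i> * integral {0<..} (\<lambda>y. chi_kernel (Complex 0 y) * (D (Complex 0 y) + D (Complex 0 (- y)))) =
      - gauss_sum / of_nat q * (\<Sum>k=1..<q. cnj (chi (int k)) * H (of_nat k / of_nat q))"
proof -
  obtain C where C: "C \<ge> 0"
    "\<And>z. \<bar>Re z\<bar> \<le> 1 / (2 * real q) \<Longrightarrow> norm (chi_kernel z) \<le> C * exp (- 2 * pi * \<bar>Im z\<bar>)"
    using chi_kernel_bound_near by blast
  define K where "K = - gauss_sum / of_nat q * (\<Sum>k=1..<q. cnj (chi (int k)) * H (of_nat k / of_nat q))"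
  define \<epsilon> where "\<epsilon> = (\<lambda>m::nat. 1 / (2 * real q * real (Suc m)))"
  define R where "R = (\<lambda>m::nat. real (Suc m))"
  define \<phi> where "\<phi> = (\<lambda>m y. chi_kernel (Complex (\<epsilon> m) y) * D (Complex (\<epsilon> m) y))"
  define f where "f = (\<lambda>m y. if y \<in> {0<..R m} then \<phi> m y + \<phi> m (- y) else 0)"
  define g where "g = (\<lambda>y. chi_kernel (Complex 0 y) * (D (Complex 0 y) + D (Complex 0 (- y))))"
  have eps: "0 < \<epsilon> m" "\<epsilon> m \<le> 1 / (2 * real q)" "\<epsilon> m < 1 / real q" "\<epsilon> m \<le> 1" for m
  proof -
    have "1 / (2 * real q * real (Suc m)) \<le> 1 / (2 * real q * 1)"
      using q_pos by (intro divide_left_mono mult_left_mono) auto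
    thus 1: "\<epsilon> m \<le> 1 / (2 * real q)" by (simp add: \<epsilon>_def)
    also have "1 / (2 * real q) < 1 / real q" using q_pos by (simp add: field_simps)
    finally show "\<epsilon> m < 1 / real q" .
    also have "1 / real q \<le> 1" using q_gt_1 by simp
    finally show "\<epsilon> m \<le> 1" by simp
    show "0 < \<epsilon> m" using q_pos by (simp add: \<epsilon>_def del: of_nat_Suc)
  qed
  have eps_lim: "\<epsilon> \<longlonglongrightarrow> 0" unfolding \<epsilon>_def using q_pos by real_asymp
  have R1: "R m \<ge> 1" for m by (simp add: R_def)
  note approx = chi_kernel_vertical_integral_approx[OF H diff bound eps(1,3) R1, folded \<phi>_def K_def]
  have fint: "(f m has_integral integral {0..R m} (\<lambda>y. \<phi> m y + \<phi> m (- y))) {0<..}" for m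
  proof -
    have "((\<lambda>y. \<phi> m y + \<phi> m (- y)) has_integral integral {0..R m} (\<lambda>y. \<phi> m y + \<phi> m (- y))) {0..R m}"
      using approx(1)[of m m] unfolding \<phi>_def by (rule integrable_integral)
    moreover have "negligible {y \<in> {0..R m} - {0<..R m}. \<phi> m y + \<phi> m (- y) \<noteq> 0}"
      by (rule negligible_subset[of "{0}"]) auto
    moreover have "negligible {y \<in> {0<..R m} - {0..R m}. \<phi> m y + \<phi> m (- y) \<noteq> 0}"
      by (rule negligible_subset[of "{}"]) auto
    ultimately have "((\<lambda>y. \<phi> m y + \<phi> m (- y)) has_integral integral {0..R m} (\<lambda>y. \<phi> m y + \<phi> m (- y))) {0<..R m}"
      using has_integral_spike_set_eq[of "{0..R m}" "{0<..R m}" "\<lambda>y. \<phi> m y + \<phi> m (- y)"] by blast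
    thus ?thesis unfolding f_def by (subst has_integral_restrict) auto
  qed
  have "(\<lambda>m. integral {0<..} (f m)) \<longlonglongrightarrow> integral {0<..} g"
  proof (rule dominated_convergence(2))
    show "f m integrable_on {0<..}" for m using fint by (auto simp: integrable_on_def)
    show "(\<lambda>y. 8 * C * ((y powr (-1/2) + 1 + y) * exp (- 2 * pi * y))) integrable_on {0<..}"
      by (intro integrable_on_mult_right integrable_dominating_function)
    fix m and y :: real assume y: "y \<in> {0<..}"
    define b where "b = C * exp (- 2 * pi * y) * (4 * (y powr (-1/2) + 1 + y))"
    have 1: "norm (\<phi> m t) \<le> b" if "\<bar>t\<bar> = y" for t
      unfolding \<phi>_def b_def norm_mult
      using C(2)[of "Complex (\<epsilon> m) t"] boundD[of "Complex (\<epsilon> m) t"] eps[of m] that y C(1)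
      by (intro mult_mono) auto
    have "norm (\<phi> m y + \<phi> m (- y)) \<le> b + b"
      using y by (intro norm_triangle_le add_mono 1) auto
    moreover have "b \<ge> 0" using C(1) y by (auto simp: b_def)
    ultimately have "norm (f m y) \<le> b + b" by (auto simp: f_def)
    thus "norm (f m y) \<le> 8 * C * ((y powr (-1/2) + 1 + y) * exp (- 2 * pi * y))"
      by (simp add: b_def algebra_simps)
  next
    fix y :: real assume y: "y \<in> {0<..}"
    have lim: "(\<lambda>m. \<phi> m t) \<longlonglongrightarrow> chi_kernel (Complex 0 t) * D (Complex 0 t)" if t: "t \<noteq> 0" for t
      unfolding \<phi>_def
    proof (intro tendsto_mult)
      have c: "(\<lambda>m. Complex (\<epsilon> m) t) \<longlonglongrightarrow> Complex 0 t" by (intro tendsto_Complex eps_lim tendsto_const)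
      show "(\<lambda>m. D (Complex (\<epsilon> m) t)) \<longlonglongrightarrow> D (Complex 0 t)"
        by (rule continuous_on_tendsto_compose[OF contD c]) (use t eps in \<open>auto intro!: always_eventually intro: less_imp_le\<close>)
      have "chi_kernel holomorphic_on ({z. - 1 / real q < Re z \<and> Re z < 1 + 1 / real q}
          - (\<lambda>k. of_nat k / of_nat q) ` {1..<q})"
        by (rule chi_kernel_holomorphic) simp
      hence ck: "continuous_on ({z. - 1 / real q < Re z \<and> Re z < 1 + 1 / real q}
          - (\<lambda>k. of_nat k / of_nat q) ` {1..<q}) chi_kernel"
        by (rule holomorphic_on_imp_continuous_on)
      have mem: "Complex x t \<in> {z. - 1 / real q < Re z \<and> Re z < 1 + 1 / real q}
          - (\<lambda>k. of_nat k / of_nat q) ` {1..<q}" if "0 \<le> x" "x < 1 / real q" for x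
      proof -
        have "Complex x t \<noteq> of_nat k / of_nat q" for k
          using t by (auto simp: complex_eq_iff)
        moreover have "- 1 / real q < 0" using q_pos by simp
        ultimately show ?thesis using that by auto
      qed
      show "(\<lambda>m. chi_kernel (Complex (\<epsilon> m) t)) \<longlonglongrightarrow> chi_kernel (Complex 0 t)"
      proof (intro continuous_on_tendsto_compose[OF ck c] always_eventually allI mem)
        show "0 \<le> \<epsilon> m" "\<epsilon> m < 1 / real q" for m using eps[of m] by auto
      qed (use q_pos in auto)
    qed
    have "- Complex 0 y = Complex 0 (- y)" by (simp add: complex_eq_iff)
    hence "chi_kernel (Complex 0 (- y)) = chi_kernel (Complex 0 y)" using chi_kernel_uminus by metis
    hence "(\<lambda>m. \<phi> m y + \<phi> m (- y)) \<longlonglongrightarrow> g y"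
      using tendsto_add[OF lim[of y] lim[of "- y"]] y by (simp add: g_def distrib_left)
    moreover have "eventually (\<lambda>m. y \<le> R m) sequentially"
      unfolding R_def by real_asymp
    hence "eventually (\<lambda>m. \<phi> m y + \<phi> m (- y) = f m y) sequentially"
      by eventually_elim (use y in \<open>simp add: f_def\<close>)
    ultimately show "(\<lambda>m. f m y) \<longlonglongrightarrow> g y" by (rule Lim_transform_eventually)
  qed
  hence "(\<lambda>m. \<i> * integral {0<..} (f m) - K) \<longlonglongrightarrow> \<i> * integral {0<..} g - K"
    by (intro tendsto_intros)
  moreover have "(\<lambda>m. \<i> * integral {0<..} (f m) - K) \<longlonglongrightarrow> 0"
  proof (rule Lim_null_comparison)
    show "eventually (\<lambda>m. norm (\<i> * integral {0<..} (f m) - K)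
        \<le> 4 * real q * exp (- 2 * pi * R m) * (Cb * (3 + R m)\<^sup>2)) sequentially"
      using approx(2) integral_unique[OF fint] unfolding \<phi>_def by (intro always_eventually allI) simp
    show "(\<lambda>m. 4 * real q * exp (- 2 * pi * R m) * (Cb * (3 + R m)\<^sup>2)) \<longlonglongrightarrow> 0"
      unfolding R_def by real_asymp
  qed
  ultimately have "\<i> * integral {0<..} g - K = 0" by (rule LIMSEQ_unique)
  thus ?thesis unfolding g_def K_def right_minus_eq .
qed

end

section \<open>The Mellin transform of the kernel\<close>

context odd_prime_character
begin

text \<open>
  Over \<open>K\<close> full periods the partial sum of the power series of \<open>chi\<close> has a closed form, bounded in norm by its limit
  when \<open>0 < w < 1\<close>. Grouping the terms in periods is what makes dominated convergence applicable below; the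
  individual terms of the Mellin transform at \<open>s = 1\<close> form a series that does not converge absolutely.
\<close>

lemma chi_partial_sum_eq:
  assumes "w ^ q \<noteq> 1"
  shows "(\<Sum>n<K * q. chi (int (Suc n)) * w ^ Suc n) = chi_poly w / (1 - w ^ q) * (1 - (w ^ q) ^ K)"
proof -
  have "(\<Sum>n<K * q. chi (int n) * w ^ n) = (\<Sum>k<K. \<Sum>n=k * q..<k * q + q. chi (int n) * w ^ n)"
    by (rule sum.nat_group[symmetric])
  also have "\<dots> = (\<Sum>k<K. chi_poly w * (w ^ q) ^ k)"
  proof (rule sum.cong[OF refl])
    fix k
    have "(\<Sum>n=k * q..<k * q + q. chi (int n) * w ^ n) = (\<Sum>a<q. chi (int (a + k * q)) * w ^ (a + k * q))"
      using sum.shift_bounds_nat_ivl[of "\<lambda>n. chi (int n) * w ^ n" 0 "k * q" q]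
      by (simp add: lessThan_atLeast0 add.commute)
    also have "\<dots> = chi_poly w * (w ^ q) ^ k"
      unfolding chi_poly_def sum_distrib_right
    proof (rule sum.cong[OF refl])
      fix a
      have "chi (int (a + k * q)) = chi (int a)" by (rule chi_cong) (simp add: cong_def)
      moreover have "w ^ (a + k * q) = w ^ a * (w ^ q) ^ k"
        by (simp add: power_add power_mult[symmetric] mult.commute)
      ultimately show "chi (int (a + k * q)) * w ^ (a + k * q) = chi (int a) * w ^ a * (w ^ q) ^ k"
        by (simp add: mult.assoc)
    qed
    finally show "(\<Sum>n=k * q..<k * q + q. chi (int n) * w ^ n) = chi_poly w * (w ^ q) ^ k" .
  qed
  finally have block: "(\<Sum>n<K * q. chi (int n) * w ^ n) = chi_poly w * (\<Sum>k<K. (w ^ q) ^ k)"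
    by (simp add: sum_distrib_left)
  have "chi (int (K * q)) = chi 0" by (rule chi_cong) (simp add: cong_def)
  hence eq1: "(\<Sum>n<Suc (K * q). chi (int n) * w ^ n) = (\<Sum>n<K * q. chi (int n) * w ^ n)" by simp
  have eq2: "(\<Sum>n<Suc (K * q). chi (int n) * w ^ n) = (\<Sum>n<K * q. chi (int (Suc n)) * w ^ Suc n)"
    by (subst sum.lessThan_Suc_shift) simp
  have "(\<Sum>n<K * q. chi (int (Suc n)) * w ^ Suc n) = chi_poly w * (\<Sum>k<K. (w ^ q) ^ k)"
    unfolding eq2[symmetric] eq1 block ..
  moreover have "1 - (w ^ q) ^ K = (1 - w ^ q) * (\<Sum>k<K. (w ^ q) ^ k)" by (rule one_diff_power_eq)
  ultimately show ?thesis using assms by simp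
qed

lemma chi_kernel_imaginary_partial_sums:
  assumes y: "y > 0"
  shows "(\<Sum>n<K * q. chi (int (Suc n)) * of_real (exp (- (2 * pi * real (Suc n)) * y))) =
    chi_kernel (Complex 0 y) * of_real (1 - exp (- (2 * pi * real q * y)) ^ K)"
proof -
  define u where "u = exp (- 2 * pi * y)"
  have u: "0 < u" "u < 1" using y by (auto simp: u_def)
  have e: "e2pi (Complex 0 y) = of_real u"
    using e2pi_imaginary[of y] by (simp add: u_def Complex_eq)
  have uq: "u ^ q < 1" using u q_pos by (simp add: power_less_one_iff)
  hence wq: "(of_real u :: complex) ^ q \<noteq> 1"
    by (metis less_irrefl of_real_eq_1_iff of_real_power)
  have "(of_real u :: complex) \<noteq> 1" using u by simp
  hence k: "chi_kernel (Complex 0 y) = chi_poly (of_real u) / (1 - of_real u ^ q)"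
    by (simp add: chi_kernel_eq e)
  have p: "u ^ n = exp (- (2 * pi * real n) * y)" for n
    by (simp add: u_def exp_of_nat_mult[symmetric] mult_ac)
  have "(\<Sum>n<K * q. chi (int (Suc n)) * of_real (exp (- (2 * pi * real (Suc n)) * y))) =
      (\<Sum>n<K * q. chi (int (Suc n)) * of_real u ^ Suc n)"
    by (simp only: p[symmetric] of_real_power)
  also have "\<dots> = chi_kernel (Complex 0 y) * (1 - (of_real u ^ q) ^ K)"
    unfolding k by (rule chi_partial_sum_eq[OF wq])
  also have "1 - ((of_real u :: complex) ^ q) ^ K = of_real (1 - (u ^ q) ^ K)" by simp
  also have "u ^ q = exp (- (2 * pi * real q * y))" by (simp add: p)
  finally show ?thesis .
qed

lemma chi_kernel_mellin:
  assumes s: "s \<ge> (1 :: real)"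
  shows "((\<lambda>y. chi_kernel (Complex 0 y) * of_real (y powr (s - 1))) has_integral
      of_real ((2 * pi) powr - s * Gamma s) * dirichlet_L chi (of_real s)) {0<..}"
proof -
  obtain C where C: "C \<ge> 0"
    "\<And>z. \<bar>Re z\<bar> \<le> 1 / (2 * real q) \<Longrightarrow> norm (chi_kernel z) \<le> C * exp (- 2 * pi * \<bar>Im z\<bar>)"
    using chi_kernel_bound_near by blast
  define c where "c = of_real ((2 * pi) powr - s * Gamma s) * dirichlet_L chi (of_real s)"
  define f where "f = (\<lambda>K y. \<Sum>n<K * q. chi (int (Suc n)) *
      of_real (y powr (s - 1) * exp (- (2 * pi * real (Suc n)) * y)))"
  define g where "g = (\<lambda>y. chi_kernel (Complex 0 y) * of_real (y powr (s - 1)))"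
  define I where "I = (\<lambda>n. chi (int (Suc n)) * complex_of_real (Gamma s / (2 * pi * real (Suc n)) powr s))"
  have f_eq: "f K y = g y * of_real (1 - exp (- (2 * pi * real q * y)) ^ K)" if "y > 0" for K y
  proof -
    have "f K y = of_real (y powr (s - 1)) *
        (\<Sum>n<K * q. chi (int (Suc n)) * of_real (exp (- (2 * pi * real (Suc n)) * y)))"
      by (simp add: f_def sum_distrib_left mult_ac)
    thus ?thesis unfolding chi_kernel_imaginary_partial_sums[OF that] by (simp add: g_def mult_ac)
  qed
  have fI: "(f K has_integral (\<Sum>n<K * q. I n)) {0<..}" for K
    unfolding f_def
  proof (rule has_integral_sum)
    fix n
    have "((\<lambda>y. y powr (s - 1) * exp (- (2 * pi * real (Suc n)) * y)) has_integral
        Gamma s / (2 * pi * real (Suc n)) powr s) {0<..}"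
      using s by (intro has_integral_Gamma_scaled) auto
    hence "((\<lambda>y. complex_of_real (y powr (s - 1) * exp (- (2 * pi * real (Suc n)) * y))) has_integral
        of_real (Gamma s / (2 * pi * real (Suc n)) powr s)) {0<..}"
      by (rule has_integral_of_real)
    thus "((\<lambda>y. chi (int (Suc n)) * complex_of_real (y powr (s - 1) * exp (- (2 * pi * real (Suc n)) * y)))
        has_integral I n) {0<..}"
      unfolding I_def by (rule has_integral_mult_right)
  qed simp
  have dc1: "f K integrable_on {0<..}" for K using fI by (auto simp: integrable_on_def)
  have dc2: "(\<lambda>y. C * (y powr (s - 1) * exp (- (2 * pi) * y))) integrable_on {0<..}"
    using s by (intro integrable_on_mult_right Gamma_scaled_integrable) auto
  have dc3: "norm (f K y) \<le> C * (y powr (s - 1) * exp (- (2 * pi) * y))" if y: "y \<in> {0<..}" for K y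
  proof -
    define v where "v = exp (- (2 * pi * real q * y))"
    have "0 \<le> v" "v \<le> 1" using y by (auto simp: v_def)
    hence v: "0 \<le> v ^ K" "v ^ K \<le> 1" by (auto intro: power_le_one)
    have "norm (f K y) = norm (g y) * \<bar>1 - v ^ K\<bar>"
      using y by (simp add: f_eq norm_mult v_def del: of_real_diff)
    also have "\<dots> \<le> norm (g y) * 1" using v by (intro mult_left_mono) auto
    also have "\<dots> \<le> C * exp (- 2 * pi * y) * y powr (s - 1)"
      using C(2)[of "Complex 0 y"] y by (simp add: g_def norm_mult mult_right_mono)
    finally show ?thesis by (simp add: mult_ac)
  qed
  have dc4: "(\<lambda>K. f K y) \<longlonglongrightarrow> g y" if y: "y \<in> {0<..}" for y
  proof -
    have "exp (- (2 * pi * real q * y)) < 1" using y q_pos by simp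
    hence "norm (exp (- (2 * pi * real q * y))) < 1" unfolding real_norm_def abs_exp_cancel .
    hence "(\<lambda>K. exp (- (2 * pi * real q * y)) ^ K) \<longlonglongrightarrow> 0" by (rule LIMSEQ_power_zero)
    hence "(\<lambda>K. g y * of_real (1 - exp (- (2 * pi * real q * y)) ^ K)) \<longlonglongrightarrow> g y * of_real (1 - 0)"
      by (intro tendsto_mult tendsto_of_real tendsto_diff tendsto_const)
    thus ?thesis using y by (simp add: f_eq)
  qed
  note dc = dominated_convergence[OF dc1 dc2 dc3 dc4]
  have "(\<lambda>n. of_real ((2 * pi) powr - s * Gamma s) * (chi (int (Suc n)) / of_nat (Suc n) powr of_real s)) sums c"
    unfolding c_def using s by (intro sums_mult dirichlet_L_sums[OF nontrivial q_pos]) simp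
  also have "(\<lambda>n. of_real ((2 * pi) powr - s * Gamma s) * (chi (int (Suc n)) / of_nat (Suc n) powr of_real s)) = I"
  proof
    fix n
    have "(of_nat (Suc n) :: complex) powr of_real s = of_real (real (Suc n) powr s)"
      using powr_of_real[of "real (Suc n)" s] by simp
    moreover have "(2 * pi * real (Suc n)) powr s = (2 * pi) powr s * real (Suc n) powr s"
      by (rule powr_mult) 
    ultimately show "of_real ((2 * pi) powr - s * Gamma s) * (chi (int (Suc n)) / of_nat (Suc n) powr of_real s) = I n"
      unfolding I_def by (simp add: powr_minus field_simps del: of_nat_Suc)
  qed
  finally have "(\<lambda>N. \<Sum>n<N. I n) \<longlonglongrightarrow> c" by (simp add: sums_def)
  moreover have "filterlim (\<lambda>K. K * q) sequentially sequentially"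
    using q_pos by (intro filterlim_subseq) (simp add: strict_mono_def)
  ultimately have "(\<lambda>K. \<Sum>n<K * q. I n) \<longlonglongrightarrow> c" by (rule filterlim_compose)
  with dc(2) have "integral {0<..} g = c"
    unfolding integral_unique[OF fI] by (rule LIMSEQ_unique)
  thus ?thesis using dc(1) unfolding g_def c_def by (metis has_integral_integral)
qed

text \<open>
  A bound that is uniform in \<open>h\<close> for the difference quotients whose limit is \<open>ln y\<close>.
\<close>

lemma powr_difference_quotient_bound:
  assumes y: "y > (0::real)" and h: "0 < h" "h \<le> 1"
  shows "\<bar>(y powr h - 1) / h\<bar> \<le> 2 * (y powr (-1/2) + y powr 1)"
proof -
  have conv: "1 + x \<le> exp x" for x :: real by (rule exp_ge_add_one_self)
  have lower: "ln y \<le> (y powr h - 1) / h"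
    using conv[of "h * ln y"] y h by (simp add: powr_def field_simps)
  define X where "X = (y powr h - 1) / h"
  have "\<bar>X\<bar> \<le> 2 * (y powr (-1/2) + y powr 1)"
  proof (cases "y \<ge> 1")
    case True
    have "y powr h \<le> 1 + h * (y - 1)"
    proof -
      have "convex_on UNIV (exp :: real \<Rightarrow> real)" by (rule exp_convex)
      hence "exp ((1 - h) *\<^sub>R 0 + h *\<^sub>R ln y) \<le> (1 - h) * exp 0 + h * exp (ln y)"
        using h by (intro convex_onD) auto
      thus ?thesis using y by (simp add: powr_def algebra_simps)
    qed
    hence "X \<le> y - 1" using h by (simp add: X_def field_simps)
    moreover have "0 \<le> ln y" using True by simp
    hence "0 \<le> X" using lower unfolding X_def by linarith
    moreover have "0 \<le> y powr (-1/2)" by simp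
    moreover have "\<bar>x\<bar> \<le> 2 * (a + y)" if "x \<le> y - 1" "0 \<le> x" "0 \<le> a" for x a
      using that y by simp
    ultimately show ?thesis unfolding powr_one[OF less_imp_le[OF y]] by blast
  next
    case False
    have "X \<le> 0"
      unfolding X_def using h y False powr_mono2[of h y 1] by (simp add: divide_le_0_iff)
    moreover have "- ln y \<le> 2 * (y powr (-1/2))"
    proof -
      have "1 + ln z \<le> z" if "z > 0" for z :: real using conv[of "ln z"] that by simp
      from this[of "y powr (-1/2)"] y show ?thesis by simp
    qed
    hence "- X \<le> 2 * (y powr (-1/2))" using lower[folded X_def] by linarith
    moreover have "0 \<le> y powr 1" "0 \<le> y powr (-1/2)" by simp_all
    moreover have "\<bar>x\<bar> \<le> 2 * (a + b)" if "x \<le> 0" "- x \<le> 2 * a" "0 \<le> b" "0 \<le> a" for x a b :: real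
      using that by simp
    ultimately show ?thesis by blast
  qed
  thus ?thesis by (simp only: X_def)
qed

text \<open>
  The derivative of the Mellin transform at \<open>s = 1\<close>, taken under the integral sign along \<open>s = 1 + h m\<close>.
\<close>

lemma chi_kernel_log_integral:
  "integral {0<..} (\<lambda>y. chi_kernel (Complex 0 y) * of_real (ln y)) =
     (deriv (dirichlet_L chi) 1 - (euler_mascheroni + of_real (ln (2 * pi))) * dirichlet_L chi 1) / (2 * of_real pi)"
proof -
  obtain C where C: "C \<ge> 0"
    "\<And>z. \<bar>Re z\<bar> \<le> 1 / (2 * real q) \<Longrightarrow> norm (chi_kernel z) \<le> C * exp (- 2 * pi * \<bar>Im z\<bar>)"
    using chi_kernel_bound_near by blast
  define \<Phi> where "\<Phi> = (\<lambda>z. (2 * of_real pi) powr - z * Gamma z * dirichlet_L chi z :: complex)"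
  define d where "d = (deriv (dirichlet_L chi) 1 - (euler_mascheroni + of_real (ln (2 * pi))) * dirichlet_L chi 1) / (2 * of_real pi)"
  define h where "h = (\<lambda>m. 1 / real (Suc m))"
  have h: "0 < h m" "h m \<le> 1" for m by (auto simp: h_def)
  have hlim: "h \<longlonglongrightarrow> 0" unfolding h_def by real_asymp
  have \<Phi>: "((\<lambda>y. chi_kernel (Complex 0 y) * of_real (y powr t)) has_integral \<Phi> (1 + of_real t)) {0<..}"
    if "t \<ge> 0" for t
  proof -
    have "of_real ((2 * pi) powr - (1 + t)) = (2 * of_real pi) powr - (1 + complex_of_real t)"
      using powr_of_real[of "2 * pi" "- (1 + t)"] by simp
    moreover have "complex_of_real (Gamma (1 + t)) = Gamma (1 + of_real t)"
      using Gamma_complex_of_real[of "1 + t"] by simp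
    ultimately show ?thesis
      using chi_kernel_mellin[of "1 + t"] that by (simp add: \<Phi>_def)
  qed
  have "(\<Phi> has_field_derivative d) (at 1)"
  proof -
    have L: "(dirichlet_L chi has_field_derivative deriv (dirichlet_L chi) 1) (at 1)"
      by (rule holomorphic_derivI[OF dirichlet_L_holomorphic[OF nontrivial q_pos] open_halfspace_Re_gt]) simp
    have "((\<lambda>z. (2 * of_real pi :: complex) powr z) has_field_derivative
        ln (2 * of_real pi) * (2 * of_real pi) powr (- 1)) (at (- 1))"
      by (rule has_field_derivative_powr_right) simp
    from DERIV_chain2[OF this DERIV_minus[OF DERIV_ident]]
    have P: "((\<lambda>z. (2 * of_real pi :: complex) powr - z) has_field_derivative
        - (ln (2 * of_real pi) * (2 * of_real pi) powr (- 1))) (at 1)" by simp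
    have G: "(Gamma has_field_derivative - euler_mascheroni) (at (1 :: complex))"
      using has_field_derivative_Gamma[of "1 :: complex" UNIV] by simp
    have ln_eq: "ln (2 * complex_of_real pi) = of_real (ln (2 * pi))"
      using Ln_of_real[of "2 * pi"] by simp
    have powr_eq: "(2 * complex_of_real pi) powr (- 1) = 1 / (2 * of_real pi)"
      by (simp only: powr_minus[of _ 1] powr_to_1 divide_inverse mult_1_left)
    show ?thesis
      unfolding \<Phi>_def
    proof (rule DERIV_cong[OF DERIV_mult[OF DERIV_mult[OF P G] L]])
      show "(- (ln (2 * complex_of_real pi) * (2 * complex_of_real pi) powr - 1) * Gamma 1
          + - euler_mascheroni * (2 * complex_of_real pi) powr - 1) * dirichlet_L chi 1
          + deriv (dirichlet_L chi) 1 * ((2 * complex_of_real pi) powr - 1 * Gamma 1) = d"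
        unfolding powr_eq ln_eq Gamma_1 d_def by (simp add: field_simps)
    qed
  qed
  hence "((\<lambda>t. (\<Phi> (1 + t) - \<Phi> 1) / t) \<longlongrightarrow> d) (at 0)" by (simp add: DERIV_def)
  moreover have "filterlim (\<lambda>m. complex_of_real (h m)) (at 0) sequentially"
  proof (rule filterlim_atI)
    show "(\<lambda>m. complex_of_real (h m)) \<longlonglongrightarrow> 0" using tendsto_of_real[OF hlim] by simp
    show "eventually (\<lambda>m. complex_of_real (h m) \<noteq> 0) sequentially"
      using h(1) by (intro always_eventually allI) (simp add: less_imp_neq[symmetric])
  qed
  ultimately have lim1: "(\<lambda>m. (\<Phi> (1 + of_real (h m)) - \<Phi> 1) / of_real (h m)) \<longlonglongrightarrow> d"
    by (rule filterlim_compose)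
  define f where "f = (\<lambda>m y. chi_kernel (Complex 0 y) * complex_of_real ((y powr h m - 1) / h m))"
  have fI: "(f m has_integral (\<Phi> (1 + of_real (h m)) - \<Phi> 1) / of_real (h m)) {0<..}" for m
  proof -
    have "((\<lambda>y. (chi_kernel (Complex 0 y) * of_real (y powr h m) - chi_kernel (Complex 0 y) * of_real (y powr 0))
        / of_real (h m)) has_integral (\<Phi> (1 + of_real (h m)) - \<Phi> (1 + of_real 0)) / of_real (h m)) {0<..}"
      using h[of m] by (intro has_integral_divide has_integral_diff \<Phi>) auto
    thus ?thesis
      by (simp only: of_real_0 add_0_right)
         (erule has_integral_eq[rotated], simp add: f_def right_diff_distrib diff_divide_distrib)
  qed
  have "(\<lambda>m. integral {0<..} (f m)) \<longlonglongrightarrow> integral {0<..} (\<lambda>y. chi_kernel (Complex 0 y) * of_real (ln y))"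
  proof (rule dominated_convergence(2))
    show "f m integrable_on {0<..}" for m using fI by (auto simp: integrable_on_def)
    show "(\<lambda>y. C * 2 * (y powr (-1/2) * exp (- (2 * pi) * y) + y powr 1 * exp (- (2 * pi) * y))) integrable_on {0<..}"
      by (intro integrable_on_mult_right integrable_add Gamma_scaled_integrable) auto
  next
    fix m and y :: real assume y: "y \<in> {0<..}"
    have "norm (f m y) \<le> (C * exp (- (2 * pi) * y)) * (2 * (y powr (-1/2) + y powr 1))"
      unfolding f_def norm_mult norm_of_real
      using C(2)[of "Complex 0 y"] C(1) y powr_difference_quotient_bound[of y "h m"] h[of m]
      by (intro mult_mono) auto
    thus "norm (f m y) \<le> C * 2 * (y powr (-1/2) * exp (- (2 * pi) * y) + y powr 1 * exp (- (2 * pi) * y))"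
      by (simp add: algebra_simps)
  next
    fix y :: real assume y: "y \<in> {0<..}"
    have "((\<lambda>t. y powr t) has_real_derivative ln y * y powr 0) (at 0)"
      using y by (auto intro!: derivative_eq_intros)
    hence "((\<lambda>t. (y powr t - 1) / t) \<longlongrightarrow> ln y) (at 0)" using y by (simp add: DERIV_def)
    moreover have "filterlim h (at 0) sequentially"
      using h(1) by (intro filterlim_atI hlim always_eventually allI) (simp add: less_imp_neq[symmetric])
    ultimately have "(\<lambda>m. (y powr h m - 1) / h m) \<longlonglongrightarrow> ln y" by (rule filterlim_compose)
    thus "(\<lambda>m. f m y) \<longlonglongrightarrow> chi_kernel (Complex 0 y) * of_real (ln y)"
      unfolding f_def by (intro tendsto_mult tendsto_of_real tendsto_const)
  qed
  with lim1 have "integral {0<..} (\<lambda>y. chi_kernel (Complex 0 y) * of_real (ln y)) = d"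
    unfolding integral_unique[OF fI] using LIMSEQ_unique by blast
  thus ?thesis by (simp add: d_def)
qed

end

section \<open>Values and logarithmic derivatives at 1\<close>

lemma solve_imaginary_multiple:
  fixes p :: complex
  assumes "\<i> * (2 * (X / (2 * p))) = t * S" "p \<noteq> 0"
  shows "X = - \<i> * p * (t * S)"
proof -
  have "X = - \<i> * p * (\<i> * (2 * (X / (2 * p))))" using assms(2) by simp
  thus ?thesis unfolding assms(1) .
qed

lemma Ln_imaginary_sum:
  assumes "y > 0"
  shows "Ln (Complex 0 y) + Ln (Complex 0 (- y)) = 2 * of_real (ln y)"
proof -
  have "Complex 0 y = of_real y * \<i>" "Complex 0 (- y) = of_real y * (- \<i>)"
    by (simp_all add: complex_eq_iff)
  thus ?thesis
    using Ln_times_of_real[OF assms, of "\<i>"] Ln_times_of_real[OF assms, of "- \<i>"]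
    by (simp add: Ln_of_real assms)
qed

context odd_prime_character
begin

lemma dirichlet_L_1_eq:
  "dirichlet_L chi 1 = \<i> * of_real pi * gauss_sum / of_nat q * bernoulli1 q (conj_character chi)"
proof -
  have "\<i> * integral {0<..} (\<lambda>y. chi_kernel (Complex 0 y) * ((\<lambda>_. 1) (Complex 0 y) + (\<lambda>_. 1) (Complex 0 (- y)))) =
      - gauss_sum / of_nat q * (\<Sum>k=1..<q. cnj (chi (int k)) * (\<lambda>z. z) (of_nat k / of_nat q))"
  proof (rule chi_kernel_contour_formula[where Cb = 1])
    show "(\<lambda>z. z) holomorphic_on {z. Re z > 0}" by (rule holomorphic_on_ident)
    show "norm z \<le> 1 * (1 + norm z)\<^sup>2" for z :: complex
      by (simp add: power2_eq_square algebra_simps)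
    show "norm (1 :: complex) \<le> 4 * (\<bar>Im z\<bar> powr (-1/2) + 1 + \<bar>Im z\<bar>)" for z
    proof -
      have "0 \<le> \<bar>Im z\<bar> powr (-1/2)" "0 \<le> \<bar>Im z\<bar>" by simp_all
      moreover have "norm (1 :: complex) \<le> 4 * (a + 1 + b)" if "0 \<le> a" "0 \<le> b" for a b :: real
        using that by simp
      ultimately show ?thesis by blast
    qed
  qed auto
  hence 1: "\<i> * (2 * integral {0<..} (\<lambda>y. chi_kernel (Complex 0 y))) =
      - gauss_sum / of_nat q * (\<Sum>k=1..<q. cnj (chi (int k)) * (of_nat k / of_nat q))"
    by (simp add: mult.commute[of _ 2])
  have "((\<lambda>y. chi_kernel (Complex 0 y) * of_real (y powr (1 - 1))) has_integral
      of_real ((2 * pi) powr - 1 * Gamma 1) * dirichlet_L chi (of_real 1)) {0<..}"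
    by (rule chi_kernel_mellin) simp
  hence "((\<lambda>y. chi_kernel (Complex 0 y)) has_integral
      of_real ((2 * pi) powr - 1 * Gamma 1) * dirichlet_L chi (of_real 1)) {0<..}"
    by (rule has_integral_eq[rotated]) simp
  hence "integral {0<..} (\<lambda>y. chi_kernel (Complex 0 y)) =
      of_real ((2 * pi) powr - 1 * Gamma 1) * dirichlet_L chi (of_real 1)"
    by (rule integral_unique)
  moreover have "(2 * pi) powr - 1 * Gamma 1 = 1 / (2 * pi)"
    by (simp add: powr_minus_divide)
  ultimately have 2: "integral {0<..} (\<lambda>y. chi_kernel (Complex 0 y)) = dirichlet_L chi 1 / (2 * of_real pi)"
    by simp
  have 3: "(\<Sum>k=1..<q. cnj (chi (int k)) * (of_nat k / of_nat q)) = bernoulli1 q (conj_character chi)"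
  proof -
    have "{1..<q} = {1..q - 1}" using q_pos by auto
    thus ?thesis by (simp add: bernoulli1_def conj_character_def sum_divide_distrib mult_ac)
  qed
  have "dirichlet_L chi 1 = - \<i> * of_real pi *
      (- gauss_sum / of_nat q * bernoulli1 q (conj_character chi))"
    using 1 unfolding 2 3 by (rule solve_imaginary_multiple) simp
  thus ?thesis by simp
qed

lemma deriv_dirichlet_L_1_eq:
  "deriv (dirichlet_L chi) 1 = (euler_mascheroni + of_real (ln (2 * pi))) * dirichlet_L chi 1 +
    \<i> * of_real pi * gauss_sum / of_nat q *
      (\<Sum>a=1..q-1. conj_character chi (int a) * of_real (ln (Gamma (real a / real q))))"
proof -
  obtain C where C: "C \<ge> 0"
    "\<And>z. Re z > 0 \<Longrightarrow> \<bar>Im z\<bar> \<ge> 1 \<Longrightarrow> norm (ln_Gamma z :: complex) \<le> C * (1 + norm z)\<^sup>2"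
    using norm_ln_Gamma_le_vertical by blast
  have "\<i> * integral {0<..} (\<lambda>y. chi_kernel (Complex 0 y) * (Ln (Complex 0 y) + Ln (Complex 0 (- y)))) =
      - gauss_sum / of_nat q * (\<Sum>k=1..<q. cnj (chi (int k)) * ln_Gamma (of_nat k / of_nat q))"
  proof (rule chi_kernel_contour_formula[OF _ _ C])
    show "ln_Gamma holomorphic_on {z. Re z > 0}"
      by (rule holomorphic_ln_Gamma) (auto simp: complex_nonpos_Reals_iff)
    show "ln_Gamma (z + 1) - ln_Gamma z = Ln z" if "Re z > 0" for z
      using ln_Gamma_plus1[OF that] by simp
    show "continuous_on ({z. Re z \<ge> 0} - {z. Im z = 0}) Ln"
      by (intro continuous_on_Ln continuous_on_id) (auto simp: complex_nonpos_Reals_iff)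
    show "norm (Ln z) \<le> 4 * (\<bar>Im z\<bar> powr (-1/2) + 1 + \<bar>Im z\<bar>)"
      if "0 \<le> Re z" "Re z \<le> 1" "Im z \<noteq> 0" for z
      using that by (rule norm_Ln_le)
  qed
  also have "integral {0<..} (\<lambda>y. chi_kernel (Complex 0 y) * (Ln (Complex 0 y) + Ln (Complex 0 (- y)))) =
      integral {0<..} (\<lambda>y. 2 * (chi_kernel (Complex 0 y) * of_real (ln y)))"
    by (rule integral_cong) (simp add: Ln_imaginary_sum)
  also have "\<dots> = 2 * integral {0<..} (\<lambda>y. chi_kernel (Complex 0 y) * of_real (ln y))" by simp
  also note chi_kernel_log_integral
  also have "(\<Sum>k=1..<q. cnj (chi (int k)) * ln_Gamma (of_nat k / of_nat q)) =
      (\<Sum>a=1..q-1. conj_character chi (int a) * of_real (ln (Gamma (real a / real q))))"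
  proof (rule sum.cong)
    fix a assume "a \<in> {1..q - 1}"
    hence a: "real a / real q > 0" using q_pos by auto
    have "ln_Gamma (of_nat a / of_nat q) = ln_Gamma (complex_of_real (real a / real q))" by simp
    also have "\<dots> = of_real (ln (Gamma (real a / real q)))"
      using a by (simp only: ln_Gamma_complex_of_real ln_Gamma_real_pos)
    finally show "cnj (chi (int a)) * ln_Gamma (of_nat a / of_nat q) =
        conj_character chi (int a) * of_real (ln (Gamma (real a / real q)))"
      by (simp add: conj_character_def)
  qed (use q_pos in auto)
  finally have eq: "\<i> * (2 * ((deriv (dirichlet_L chi) 1 -
        (euler_mascheroni + of_real (ln (2 * pi))) * dirichlet_L chi 1) / (2 * of_real pi))) =
      - gauss_sum / of_nat q *
        (\<Sum>a=1..q-1. conj_character chi (int a) * of_real (ln (Gamma (real a / real q))))" .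
  have "deriv (dirichlet_L chi) 1 - (euler_mascheroni + of_real (ln (2 * pi))) * dirichlet_L chi 1 =
      - \<i> * of_real pi * (- gauss_sum / of_nat q *
        (\<Sum>a=1..q-1. conj_character chi (int a) * of_real (ln (Gamma (real a / real q)))))"
    by (rule solve_imaginary_multiple[OF eq]) simp
  hence "deriv (dirichlet_L chi) 1 =
      - \<i> * of_real pi * (- gauss_sum / of_nat q *
        (\<Sum>a=1..q-1. conj_character chi (int a) * of_real (ln (Gamma (real a / real q)))))
      + (euler_mascheroni + of_real (ln (2 * pi))) * dirichlet_L chi 1"
    by (simp only: diff_eq_eq)
  thus ?thesis by simp
qed

lemma q_odd: "odd q"
proof (rule ccontr)
  assume "\<not> odd q"
  hence "q = 2" using prime_q by (metis primes_dvd_imp_eq two_is_prime_nat)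
  hence "[-1 = 1] (mod int q)" by (simp add: cong_def)
  hence "chi (-1) = chi 1" by (rule chi_cong)
  thus False using dirichlet_character_1[OF character] odd_chi by (simp add: odd_characters_def)
qed

text \<open>
  For a quadratic character, \<open>q\<close> times the Bernoulli number is the sum of \<open>a\<close> or \<open>- a\<close> over \<open>0 < a < q\<close>, an
  integer of the same parity as \<open>q (q - 1) / 2\<close>. The latter is odd: \<open>chi (-1)\<close> would be \<open>1\<close> if \<open>(q - 1) / 2\<close> were
  even.
\<close>

lemma bernoulli1_nonzero_quadratic:
  assumes quad: "(\<lambda>n. chi n ^ 2) = principal_character q"
  shows "bernoulli1 q (conj_character chi) \<noteq> 0"
proof
  assume "bernoulli1 q (conj_character chi) = 0"
  define m where "m = (q - 1) div 2"
  have m: "q = 2 * m + 1" using q_odd by (auto simp: m_def elim!: oddE)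
  have sq: "chi n ^ 2 = 1" if "coprime n (int q)" for n
    using fun_cong[OF quad, of n] that by (simp add: principal_character_def)
  have "odd m"
  proof
    assume "even m"
    then obtain k where k: "m = 2 * k" by (auto elim!: evenE)
    obtain g where g: "coprime q g" "ord q g = q - 1"
      using primitive_root_exists[OF prime_q q_odd] by blast
    have "chi (-1) = chi (int (g ^ m))"
      using primitive_root_half_power[OF prime_q q_odd g] unfolding m_def by (intro chi_cong) (rule cong_sym)
    also have "\<dots> = (chi (int g) ^ 2) ^ k"
      by (simp add: dirichlet_character_power[OF character] k power_mult)
    also have "\<dots> = 1" using g(1) by (simp add: sq coprime_commute)
    finally show False using odd_chi by (simp add: odd_characters_def)
  qed
  \<comment> \<open>The values of the character as integers.\<close>
  define c where "c = (\<lambda>a::nat. if chi (int a) = 1 then 1 else - 1 :: int)"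
  have c: "cnj (chi (int a)) = of_int (c a)" if "a \<in> {1..q - 1}" for a
  proof -
    have "coprime (int a) (int q)" using that q_pos by (intro coprime_q) auto
    hence "chi (int a) = 1 \<or> chi (int a) = - 1" using sq power2_eq_1_iff by blast
    thus ?thesis by (auto simp: c_def)
  qed
  have "0 = of_nat q * bernoulli1 q (conj_character chi)"
    using \<open>bernoulli1 q (conj_character chi) = 0\<close> by simp
  also have "\<dots> = (\<Sum>a=1..q-1. of_nat a * of_int (c a))"
    using q_pos c by (simp add: bernoulli1_def conj_character_def)
  also have "\<dots> = of_int (\<Sum>a=1..q-1. int a * c a)" by simp
  finally have "of_int (\<Sum>a=1..q-1. int a * c a) = (0 :: complex)" ..
  hence 0: "(\<Sum>a=1..q-1. int a * c a) = 0" by (simp only: of_int_eq_0_iff)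
  have "even ((\<Sum>a=1..q-1. int a * c a) - (\<Sum>a=1..q-1. int a))"
    unfolding sum_subtractf[symmetric] by (intro dvd_sum) (simp add: c_def)
  moreover have "(\<Sum>a=1..n. int a) * 2 = int n * (int n + 1)" for n
    by (induction n) (simp_all add: algebra_simps)
  from this[of "q - 1"] have "(\<Sum>a=1..q-1. int a) = int m * int q"
    using m by (simp add: algebra_simps)
  ultimately show False using 0 \<open>odd m\<close> q_odd by simp
qed

lemma dirichlet_L_1_nonzero: "dirichlet_L chi 1 \<noteq> 0"
proof (cases "(\<lambda>n. chi n ^ 2) = principal_character q")
  case True
  thus ?thesis
    using bernoulli1_nonzero_quadratic gauss_sum_nonzero q_pos by (simp add: dirichlet_L_1_eq)
next
  case False
  have "dirichlet_character q (\<lambda>n. chi n ^ 2)"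
    using character by (simp add: dirichlet_character_def power_mult_distrib)
  hence "(\<lambda>n. chi n ^ 2) \<in> nontrivial_characters q" using False by (simp add: nontrivial_characters_def)
  thus ?thesis by (rule dirichlet_L_nonzero_complex[OF nontrivial q_pos])
qed

lemma L_logderiv_at_1_eq:
  "L_logderiv_at_1 chi = euler_mascheroni + of_real (ln (2 * pi)) +
    1 / bernoulli1 q (conj_character chi) *
      (\<Sum>a=1..q-1. conj_character chi (int a) * of_real (ln (Gamma (real a / real q))))"
proof -
  define c where "c = \<i> * of_real pi * gauss_sum / of_nat q"
  define B where "B = bernoulli1 q (conj_character chi)"
  have L: "dirichlet_L chi 1 = c * B" unfolding c_def B_def by (rule dirichlet_L_1_eq)
  hence "c \<noteq> 0" "B \<noteq> 0" using dirichlet_L_1_nonzero by auto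
  thus ?thesis
    unfolding L_logderiv_at_1_def deriv_dirichlet_L_1_eq unfolding L c_def[symmetric] B_def[symmetric]
    by (simp add: field_simps)
qed

end

theorem mainTheorem2:
  fixes q :: nat
  assumes "prime q" and "odd q"
  shows "euler_kronecker q - euler_kronecker_plus q = (\<Sum>chi\<in>odd_characters q. L_logderiv_at_1 chi) \<and>
         (\<Sum>chi\<in>odd_characters q. L_logderiv_at_1 chi) =
           (of_nat q - 1) / 2 * (euler_mascheroni + of_real (ln (2 * pi))) +
           (\<Sum>chi\<in>odd_characters q.
              1 / bernoulli1 q (conj_character chi) *
              (\<Sum>a = 1..q-1. conj_character chi (int a) *
                 of_real (ln (Gamma (real a / real q)))))"
proof
  show "euler_kronecker q - euler_kronecker_plus q = (\<Sum>chi\<in>odd_characters q. L_logderiv_at_1 chi)"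
    using assms(1) by (intro euler_kronecker_diff prime_gt_0_nat)
  have "(\<Sum>chi\<in>odd_characters q. L_logderiv_at_1 chi) =
      (\<Sum>chi\<in>odd_characters q. euler_mascheroni + of_real (ln (2 * pi)) +
        1 / bernoulli1 q (conj_character chi) *
        (\<Sum>a = 1..q-1. conj_character chi (int a) * of_real (ln (Gamma (real a / real q)))))"
  proof (rule sum.cong[OF refl])
    fix chi assume "chi \<in> odd_characters q"
    then interpret odd_prime_character q chi using assms(1) by unfold_locales
    show "L_logderiv_at_1 chi = euler_mascheroni + of_real (ln (2 * pi)) +
        1 / bernoulli1 q (conj_character chi) *
        (\<Sum>a = 1..q-1. conj_character chi (int a) * of_real (ln (Gamma (real a / real q))))"
      by (rule L_logderiv_at_1_eq)
  qed
  moreover have "of_nat (card (odd_characters q)) = (of_nat q - 1) / (2 :: complex)"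
    using assms(2) by (auto simp: card_odd_characters[OF assms] elim!: oddE)
  ultimately show "(\<Sum>chi\<in>odd_characters q. L_logderiv_at_1 chi) =
           (of_nat q - 1) / 2 * (euler_mascheroni + of_real (ln (2 * pi))) +
           (\<Sum>chi\<in>odd_characters q.
              1 / bernoulli1 q (conj_character chi) *
              (\<Sum>a = 1..q-1. conj_character chi (int a) *
                 of_real (ln (Gamma (real a / real q)))))"
    by (simp only: sum.distrib sum_constant distrib_left)
qed

end
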